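(* The set $\mathcal{B}$ consists precisely of $2P_3$, $2K_2\cup K_{1,3}$ and their subgraphs of order at least $3$ (without isolated vertices). That is, a bipartite graph $H$ of order at least $3$ without isolated vertices belongs to $\mathcal{B}$ if and only if $H$ is isomorphic to a subgraph of $2P_3$ or of $2K_2\cup K_{1,3}$.
   Context: All graphs are finite and simple; the order of a graph is its number of vertices. $P_n$ is the path on $n$ vertices, $G\cup H$ denotes the disjoint union, and $nG$ denotes the disjoint union of $n$ copies of $G$. An edge-coloring of $K_{s,t}$ "using all the $m$ colors" is a surjective map $c:E(K_{s,t})\to\{1,\dots,m\}$. A colored graph is rainbow if all its edges have different colors, and monochromatic if all its edges have the same color. A coloring is rainbow $H$-free if it contains no rainbow subgraph isomorphic to $H$. $\mathcal{B}$ is the set of bipartite graphs $H$ of order at least $3$ without isolated vertices such that for positive integers $s,t,k,m$ with $\min\{s,t\}\gg m\gg k$ and $m\ge|E(H)|$, there is a $k$-connected monochromatic subgraph of order at least $s+t-f(H,k,m)$ in every rainbow $H$-free coloring of $K_{s,t}$ using all the $m$ colors, where $f(H,k,m)$ does not depend on $s$ and $t$. Explicitly: for every $k\ge1$ there is $m_0$ such that for every $m\ge\max\{m_0,|E(H)|\}$ there are $N_0$ and a constant $f$ such that for all $s,t$ with $\min\{s,t\}\ge N_0$, every rainbow $H$-free coloring of $K_{s,t}$ using all the $m$ colors contains a $k$-connected monochromatic subgraph of order at least $s+t-f$. *)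

theory Defs
  imports Main
begin

datatype 'a ugraph = UGraph (verts: "'a set") (edges: "'a set set")

definition simple_graph :: "'a ugraph \<Rightarrow> bool" where
  "simple_graph G \<longleftrightarrow> finite (verts G) \<and> (\<forall>e\<in>edges G. e \<subseteq> verts G \<and> card e = 2)"

definition order :: "'a ugraph \<Rightarrow> nat" where
  "order G = card (verts G)"

definition subgraph :: "'a ugraph \<Rightarrow> 'a ugraph \<Rightarrow> bool" where
  "subgraph F G \<longleftrightarrow> simple_graph F \<and> verts F \<subseteq> verts G \<and> edges F \<subseteq> edges G"

definition graph_iso :: "'a ugraph \<Rightarrow> 'b ugraph \<Rightarrow> bool" where
  "graph_iso G H \<longleftrightarrow>
     (\<exists>f. bij_betw f (verts G) (verts H) \<and> (\<lambda>e. f ` e) ` edges G = edges H)"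

definition bipartite :: "'a ugraph \<Rightarrow> bool" where
  "bipartite G \<longleftrightarrow> (\<exists>A B. A \<union> B = verts G \<and> A \<inter> B = {} \<and>
     (\<forall>e\<in>edges G. \<exists>a\<in>A. \<exists>b\<in>B. e = {a, b}))"

definition no_isolated_vertices :: "'a ugraph \<Rightarrow> bool" where
  "no_isolated_vertices G \<longleftrightarrow> (\<forall>v\<in>verts G. \<exists>e\<in>edges G. v \<in> e)"

definition path_graph :: "nat \<Rightarrow> nat ugraph" where
  "path_graph n = UGraph {..<n} {{i, Suc i} | i. Suc i < n}"

definition complete_graph :: "nat \<Rightarrow> nat ugraph" where
  "complete_graph n = UGraph {..<n} {e. e \<subseteq> {..<n} \<and> card e = 2}"

definition complete_bipartite :: "nat \<Rightarrow> nat \<Rightarrow> (nat + nat) ugraph" where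
  "complete_bipartite s t =
     UGraph ({..<s} <+> {..<t}) {{Inl i, Inr j} | i j. i < s \<and> j < t}"

definition disjoint_union :: "'a ugraph \<Rightarrow> 'b ugraph \<Rightarrow> ('a + 'b) ugraph" where
  "disjoint_union G H =
     UGraph (verts G <+> verts H)
       ((\<lambda>e. Inl ` e) ` edges G \<union> (\<lambda>e. Inr ` e) ` edges H)"

definition copies :: "nat \<Rightarrow> 'a ugraph \<Rightarrow> (nat \<times> 'a) ugraph" where
  "copies n G = UGraph ({..<n} \<times> verts G) {Pair i ` e | i e. i < n \<and> e \<in> edges G}"

definition delete_vertices :: "'a ugraph \<Rightarrow> 'a set \<Rightarrow> 'a ugraph" where
  "delete_vertices G S = UGraph (verts G - S) {e \<in> edges G. e \<inter> S = {}}"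

definition connected_graph :: "'a ugraph \<Rightarrow> bool" where
  "connected_graph G \<longleftrightarrow> verts G \<noteq> {} \<and>
     (\<forall>u\<in>verts G. \<forall>v\<in>verts G. (u, v) \<in> {(x, y). {x, y} \<in> edges G}\<^sup>*)"

definition k_connected :: "nat \<Rightarrow> 'a ugraph \<Rightarrow> bool" where
  "k_connected k G \<longleftrightarrow> k < order G \<and>
     (\<forall>S\<subseteq>verts G. card S < k \<longrightarrow> connected_graph (delete_vertices G S))"

text \<open>Colorings are functions on all sets of vertices; only their values on the edges of
  the colored graph matter.\<close>

definition coloring_using :: "'a ugraph \<Rightarrow> nat \<Rightarrow> ('a set \<Rightarrow> nat) \<Rightarrow> bool" where
  "coloring_using G m c \<longleftrightarrow> c ` edges G = {1..m}"

definition rainbow :: "('a set \<Rightarrow> nat) \<Rightarrow> 'a ugraph \<Rightarrow> bool" where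
  "rainbow c F \<longleftrightarrow> inj_on c (edges F)"

definition monochromatic :: "('a set \<Rightarrow> nat) \<Rightarrow> 'a ugraph \<Rightarrow> bool" where
  "monochromatic c F \<longleftrightarrow> (\<forall>e\<in>edges F. \<forall>e'\<in>edges F. c e = c e')"

definition rainbow_free :: "'b ugraph \<Rightarrow> 'a ugraph \<Rightarrow> ('a set \<Rightarrow> nat) \<Rightarrow> bool" where
  "rainbow_free H G c \<longleftrightarrow> \<not> (\<exists>F. subgraph F G \<and> graph_iso F H \<and> rainbow c F)"

text \<open>The hierarchy \<open>min s t \<ggreater> m \<ggreater> k\<close> is rendered by the thresholds \<open>m\<^sub>0\<close> (depending on
  \<open>H\<close> and \<open>k\<close>) and \<open>N\<^sub>0\<close> (depending on \<open>H\<close>, \<open>k\<close> and \<open>m\<close>). The bound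
  \<open>order F \<ge> s + t - f\<close> is written additively because of truncated subtraction.\<close>

definition class_B :: "'a ugraph set" where
  "class_B = {H. simple_graph H \<and> bipartite H \<and> order H \<ge> 3 \<and> no_isolated_vertices H \<and>
     (\<forall>k\<ge>1. \<exists>m\<^sub>0. \<forall>m\<ge>max m\<^sub>0 (card (edges H)). \<exists>N\<^sub>0 f. \<forall>s t. min s t \<ge> N\<^sub>0 \<longrightarrow>
       (\<forall>c. coloring_using (complete_bipartite s t) m c \<and>
            rainbow_free H (complete_bipartite s t) c \<longrightarrow>
          (\<exists>F. subgraph F (complete_bipartite s t) \<and> monochromatic c F \<and>
               k_connected k F \<and> s + t \<le> order F + f)))}"

end

theory Submission
  imports Defs
begin

text \<open>
  Write \<open>K\<close> for the coloured \<open>K\<^bsub>s,t\<^esub>\<close>.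

  Both graphs \<open>2P\<^sub>3\<close> and \<open>2K\<^sub>2 \<union> K\<^bsub>1,3\<^esub>\<close> are handled by one argument showing that they, and hence their
  subgraphs, belong to the class. Pick one edge of each colour; this touches at most \<open>2m\<close> vertices.
  If the remaining complete bipartite graph is monochromatic, it is the required subgraph.
  Otherwise it contains a rainbow \<open>P\<^sub>3\<close> and a rainbow \<open>2K\<^sub>2\<close>, in colours \<open>\<alpha>\<close> and \<open>\<beta>\<close>.
  Since \<open>K\<close> has no rainbow \<open>H\<close>, three of the picked edges with other colours cannot share a
  vertex, so many of the picked edges form a rainbow matching
  (\<open>rainbow_matching_of_two_coloured_rest\<close>). Next to such a matching, a vertex that sees
  three colours would produce a rainbow copy of each of the two graphs
  (\<open>rainbow_copies_at_three_coloured_vertex\<close>). So every vertex sees at most two colours. Adjacent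
  vertices see a common colour, and each colour is seen on both sides; two families of sets with at
  most two elements that meet in this way and cover many colours have an element \<open>\<alpha>\<close> common to all their members
  (\<open>cross_intersecting_pairs_common_element\<close>). Hence the colours other than \<open>\<alpha>\<close> live on disjoint
  blocks, edges between different blocks have colour \<open>\<alpha>\<close>, and one vertex per block and side
  is a set of hubs that makes the graph of colour \<open>\<alpha>\<close> highly connected and spanning
  (\<open>monochromatic_of_locally_two_coloured\<close>).

  Conversely, three colourings without a large connected monochromatic subgraph each
  force \<open>H\<close> to have a rainbow copy. Colouring \<open>{i, j}\<close> by \<open>i mod m\<close> forces a star forest. Two
  colours that alternate over the rows, together with a rainbow star, force all edges but two to share a
  vertex; with a rainbow matching in place of the star, they force all edges but two to be disjoint.
  A star forest with both properties has a star with at most three edges and at most two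
  edges elsewhere, with at most two edges in the star if the other two share a vertex
  (\<open>star_forest_embeds\<close>). This describes the subgraphs of the two graphs.
\<close>

section \<open>Embeddings and rainbow copies\<close>

text \<open>Embeddings replace isomorphisms onto subgraphs throughout: they compose, and they can be given
  by listing the images of the vertices.\<close>

definition embedding :: "('a \<Rightarrow> 'b) \<Rightarrow> 'a ugraph \<Rightarrow> 'b ugraph \<Rightarrow> bool" where
  "embedding \<phi> H G \<longleftrightarrow> inj_on \<phi> (verts H) \<and> \<phi> ` verts H \<subseteq> verts G \<and> (\<forall>e\<in>edges H. \<phi> ` e \<in> edges G)"

lemma embeddingI:
  assumes "inj_on \<phi> (verts H)" "\<phi> ` verts H \<subseteq> verts G" "\<And>e. e \<in> edges H \<Longrightarrow> \<phi> ` e \<in> edges G"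
  shows "embedding \<phi> H G"
  using assms by (simp add: embedding_def)

definition rainbow_copy :: "('b set \<Rightarrow> nat) \<Rightarrow> 'a ugraph \<Rightarrow> 'b ugraph \<Rightarrow> bool" where
  "rainbow_copy c H G \<longleftrightarrow> (\<exists>\<phi>. embedding \<phi> H G \<and> inj_on (\<lambda>e. c (\<phi> ` e)) (edges H))"

lemma simple_graph_edge:
  assumes "simple_graph G" "e \<in> edges G"
  shows "e \<subseteq> verts G" "card e = 2"
  using assms by (auto simp: simple_graph_def)

lemma subgraph_image_of_embedding:
  assumes "simple_graph H" "embedding \<phi> H G"
  defines "F \<equiv> UGraph (\<phi> ` verts H) ((\<lambda>e. \<phi> ` e) ` edges H)"
  shows "subgraph F G" "graph_iso H F"
proof -
  have "card (\<phi> ` e) = 2" if "e \<in> edges H" for e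
    using assms(2) simple_graph_edge[OF assms(1) that]
    by (metis card_image embedding_def inj_on_subset)
  then have "simple_graph F"
    using assms(1) by (auto simp: simple_graph_def F_def)
  then show "subgraph F G"
    using assms(2) by (auto simp: subgraph_def embedding_def F_def)
  show "graph_iso H F"
    using assms(2) by (auto simp: graph_iso_def embedding_def F_def bij_betw_def intro!: exI[of _ \<phi>])
qed

lemma copy_iff_embedding:
  assumes "simple_graph H"
  shows "(\<exists>F. subgraph F G \<and> graph_iso H F) \<longleftrightarrow> (\<exists>\<phi>. embedding \<phi> H G)"
proof
  assume "\<exists>F. subgraph F G \<and> graph_iso H F"
  then obtain F \<phi> where "subgraph F G" "bij_betw \<phi> (verts H) (verts F)"
      "(\<lambda>e. \<phi> ` e) ` edges H = edges F"
    by (auto simp: graph_iso_def)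
  then have "embedding \<phi> H G"
    by (auto simp: embedding_def subgraph_def bij_betw_def)
  then show "\<exists>\<phi>. embedding \<phi> H G"
    by blast
qed (use subgraph_image_of_embedding[OF assms] in blast)

lemma graph_iso_sym:
  assumes "simple_graph G" "graph_iso G H"
  shows "graph_iso H G"
proof -
  from assms(2) obtain f where f: "bij_betw f (verts G) (verts H)"
      "(\<lambda>e. f ` e) ` edges G = edges H"
    by (auto simp: graph_iso_def)
  let ?g = "inv_into (verts G) f"
  have "?g ` f ` e = e" if "e \<in> edges G" for e
    using f(1) simple_graph_edge(1)[OF assms(1) that]
    by (simp add: bij_betw_imp_inj_on inv_into_image_cancel)
  then have "(\<lambda>e. ?g ` e) ` edges H = edges G"
    unfolding f(2)[symmetric] image_image by simp
  then show ?thesis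
    using bij_betw_inv_into[OF f(1)] by (auto simp: graph_iso_def)
qed

lemma rainbow_free_iff:
  assumes "simple_graph H"
  shows "rainbow_free H G c \<longleftrightarrow> \<not> rainbow_copy c H G"
proof -
  have "rainbow_copy c H G" if "subgraph F G" "graph_iso F H" "rainbow c F" for F
  proof -
    have "graph_iso H F"
      using graph_iso_sym that by (auto simp: subgraph_def)
    then obtain \<phi> where \<phi>: "bij_betw \<phi> (verts H) (verts F)"
        "(\<lambda>e. \<phi> ` e) ` edges H = edges F"
      by (auto simp: graph_iso_def)
    have emb: "embedding \<phi> H G"
      using \<phi> that(1) by (auto simp: embedding_def subgraph_def bij_betw_def)
    have "inj_on (\<lambda>e. \<phi> ` e) (edges H)"
      using \<phi>(1) simple_graph_edge(1)[OF assms]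
      by (intro inj_onI) (metis bij_betw_imp_inj_on inj_on_image_eq_iff)
    then have "inj_on (c \<circ> (\<lambda>e. \<phi> ` e)) (edges H)"
      using that(3) \<phi>(2) by (intro comp_inj_on) (auto simp: rainbow_def)
    then show ?thesis
      using emb by (auto simp: rainbow_copy_def o_def)
  qed
  moreover have "\<exists>F. subgraph F G \<and> graph_iso F H \<and> rainbow c F" if "rainbow_copy c H G"
  proof -
    from that obtain \<phi> where \<phi>: "embedding \<phi> H G" "inj_on (\<lambda>e. c (\<phi> ` e)) (edges H)"
      by (auto simp: rainbow_copy_def)
    let ?F = "UGraph (\<phi> ` verts H) ((\<lambda>e. \<phi> ` e) ` edges H)"
    have "rainbow c ?F"
      using \<phi>(2) by (auto simp: rainbow_def inj_on_def)
    then show ?thesis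
      using subgraph_image_of_embedding[OF assms \<phi>(1)] graph_iso_sym[OF assms] by blast
  qed
  ultimately show ?thesis
    by (auto simp: rainbow_free_def)
qed

text \<open>This is why it suffices to treat the two maximal graphs.\<close>

lemma rainbow_copy_of_subgraph:
  assumes "simple_graph H" "embedding \<psi> H H'" "rainbow_copy c H' G"
  shows "rainbow_copy c H G"
proof -
  from assms(3) obtain \<phi> where \<phi>: "embedding \<phi> H' G" "inj_on (\<lambda>e. c (\<phi> ` e)) (edges H')"
    by (auto simp: rainbow_copy_def)
  have "embedding (\<phi> \<circ> \<psi>) H G"
    unfolding embedding_def
  proof (intro conjI ballI)
    show "inj_on (\<phi> \<circ> \<psi>) (verts H)"
      using assms(2) \<phi>(1) by (auto simp: embedding_def intro!: comp_inj_on intro: inj_on_subset)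
    show "(\<phi> \<circ> \<psi>) ` verts H \<subseteq> verts G"
      using assms(2) \<phi>(1) unfolding embedding_def image_comp[symmetric] by blast
    show "(\<phi> \<circ> \<psi>) ` e \<in> edges G" if "e \<in> edges H" for e
      using assms(2) \<phi>(1) that unfolding embedding_def image_comp[symmetric] by blast
  qed
  moreover have "inj_on (\<lambda>e. c ((\<phi> \<circ> \<psi>) ` e)) (edges H)"
  proof (intro inj_onI)
    fix d e assume de: "d \<in> edges H" "e \<in> edges H" "c ((\<phi> \<circ> \<psi>) ` d) = c ((\<phi> \<circ> \<psi>) ` e)"
    have "c (\<phi> ` \<psi> ` d) = c (\<phi> ` \<psi> ` e)"
      using de(3) by (simp only: image_comp)
    moreover have "\<psi> ` d \<in> edges H'" "\<psi> ` e \<in> edges H'"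
      using assms(2) de(1,2) by (auto simp: embedding_def)
    ultimately have "\<psi> ` d = \<psi> ` e"
      using inj_onD[OF \<phi>(2)] by blast
    then show "d = e"
      using assms(2) de simple_graph_edge(1)[OF assms(1)]
      by (metis embedding_def inj_on_image_eq_iff)
  qed
  ultimately show ?thesis
    by (auto simp: rainbow_copy_def)
qed

abbreviation (input) two_P3 :: "(nat \<times> nat) ugraph" where
  "two_P3 \<equiv> copies 2 (path_graph 3)"

abbreviation (input) claw_2K2 :: "((nat \<times> nat) + (nat + nat)) ugraph" where
  "claw_2K2 \<equiv> disjoint_union (copies 2 (complete_graph 2)) (complete_bipartite 1 3)"

lemma verts_two_P3: "verts two_P3 = {(0,0), (0,1), (0,2), (1,0), (1,1), (1,2)}"
  by (auto simp: copies_def path_graph_def)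

lemma edges_two_P3: "edges two_P3 = {{(0,1), (0,0)}, {(0,1), (0,2)}, {(1,1), (1,0)}, {(1,1), (1,2)}}"
proof -
  have "edges (path_graph 3) = {{1, 0}, {1, 2}}"
  proof -
    have "Suc i < 3 \<longleftrightarrow> i = 0 \<or> i = 1" for i by auto
    then show ?thesis by (auto simp: path_graph_def numeral_2_eq_2)
  qed
  moreover have "i < 2 \<longleftrightarrow> i = 0 \<or> i = 1" for i :: nat by auto
  ultimately have "edges two_P3 = {Pair i ` e | i e. (i = 0 \<or> i = 1) \<and> (e = {1, 0} \<or> e = {1, 2})}"
    by (simp add: copies_def)
  also have "\<dots> = {Pair 0 ` {1, 0}, Pair 0 ` {1, 2}, Pair 1 ` {1, 0}, Pair 1 ` {1, 2}}"
    by blast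
  finally show ?thesis
    by simp
qed

lemma verts_claw_2K2:
  "verts claw_2K2 = {Inl (0,0), Inl (0,1), Inl (1,0), Inl (1,1),
     Inr (Inl 0), Inr (Inr 0), Inr (Inr 1), Inr (Inr 2)}"
  by (auto simp: copies_def complete_graph_def disjoint_union_def complete_bipartite_def)

lemma edges_claw_2K2:
  "edges claw_2K2 = {{Inl (0,0), Inl (0,1)}, {Inl (1,0), Inl (1,1)},
     {Inr (Inl 0), Inr (Inr 0)}, {Inr (Inl 0), Inr (Inr 1)}, {Inr (Inl 0), Inr (Inr 2)}}"
proof -
  have lt: "i < 2 \<longleftrightarrow> i = 0 \<or> i = 1" "i < 3 \<longleftrightarrow> i = 0 \<or> i = 1 \<or> i = 2" for i :: nat
    by auto
  have "edges (complete_graph 2) = {{0, 1}}"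
  proof -
    have "e = {0, 1}" if "e \<subseteq> {..<2}" "card e = 2" for e :: "nat set"
    proof -
      have "e = {..<2}" using that by (intro card_subset_eq) auto
      then show ?thesis by auto
    qed
    then show ?thesis by (auto simp: complete_graph_def)
  qed
  then have 1: "edges (copies 2 (complete_graph 2)) = {{(0,0), (0,1)}, {(1,0), (1,1)}}"
    by (auto simp: copies_def lt)
  have 2: "edges (complete_bipartite 1 3) = {{Inl 0, Inr 0}, {Inl 0, Inr 1}, {Inl 0, Inr 2}}"
    by (auto simp: complete_bipartite_def lt)
  show ?thesis
    by (simp add: disjoint_union_def 1 2 insert_commute del: One_nat_def)
qed

lemma rainbow_two_P3I:
  assumes "simple_graph G"
    and "{v, a} \<in> edges G" "{v, b} \<in> edges G" "{v', a'} \<in> edges G" "{v', b'} \<in> edges G"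
    and "distinct [v, a, b, v', a', b']"
    and "distinct [c {v, a}, c {v, b}, c {v', a'}, c {v', b'}]"
  shows "rainbow_copy c two_P3 G"
proof -
  define \<phi> where "\<phi> p = (if p = (0,0) then a else if p = (0,1) then v else if p = (0,2) then b
    else if p = (1,0) then a' else if p = (1,1) then v' else b')" for p :: "nat \<times> nat"
  have \<phi>_vals: "\<phi> (0,0) = a" "\<phi> (0,1) = v" "\<phi> (0,2) = b" "\<phi> (1,0) = a'" "\<phi> (1,1) = v'" "\<phi> (1,2) = b'"
    by (simp_all add: \<phi>_def)
  have V: "v \<in> verts G" "a \<in> verts G" "b \<in> verts G" "v' \<in> verts G" "a' \<in> verts G" "b' \<in> verts G"
    using assms simple_graph_edge(1)[OF assms(1)] by auto
  have "inj_on \<phi> (verts two_P3)"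
    unfolding verts_two_P3 using assms(6) by (simp add: \<phi>_vals eq_commute del: One_nat_def)
  then have "embedding \<phi> two_P3 G"
    unfolding embedding_def verts_two_P3 edges_two_P3 using assms V
    by (simp add: \<phi>_vals insert_commute del: One_nat_def)
  moreover
  have "distinct (map (\<lambda>e. c (\<phi> ` e)) [{(0,1), (0,0)}, {(0,1), (0,2)}, {(1,1), (1,0)}, {(1,1), (1,2)}])"
    using assms(7) by (simp add: \<phi>_vals insert_commute eq_commute del: One_nat_def)
  then have "inj_on (\<lambda>e. c (\<phi> ` e)) (edges two_P3)"
    by (simp only: distinct_map edges_two_P3 list.set)
  ultimately show ?thesis
    by (auto simp: rainbow_copy_def)
qed

lemma rainbow_claw_2K2I:
  assumes "simple_graph G"
    and "{v, a} \<in> edges G" "{v, b} \<in> edges G" "{v, d} \<in> edges G"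
    and "{x, y} \<in> edges G" "{x', y'} \<in> edges G"
    and "distinct [v, a, b, d, x, y, x', y']"
    and "distinct [c {v, a}, c {v, b}, c {v, d}, c {x, y}, c {x', y'}]"
  shows "rainbow_copy c claw_2K2 G"
proof -
  define \<phi> where "\<phi> p = (if p = Inl (0,0) then x else if p = Inl (0,1) then y
    else if p = Inl (1,0) then x' else if p = Inl (1,1) then y'
    else if p = Inr (Inl 0) then v else if p = Inr (Inr 0) then a
    else if p = Inr (Inr 1) then b else d)" for p :: "(nat \<times> nat) + (nat + nat)"
  have \<phi>_vals: "\<phi> (Inl (0,0)) = x" "\<phi> (Inl (0,1)) = y" "\<phi> (Inl (1,0)) = x'" "\<phi> (Inl (1,1)) = y'" "\<phi> (Inr (Inl 0)) = v" "\<phi> (Inr (Inr 0)) = a" "\<phi> (Inr (Inr 1)) = b" "\<phi> (Inr (Inr 2)) = d"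
    by (simp_all add: \<phi>_def)
  have V: "v \<in> verts G" "a \<in> verts G" "b \<in> verts G" "d \<in> verts G"
      "x \<in> verts G" "y \<in> verts G" "x' \<in> verts G" "y' \<in> verts G"
    using assms simple_graph_edge(1)[OF assms(1)] by auto
  have "inj_on \<phi> (verts claw_2K2)"
    unfolding verts_claw_2K2 using assms(7) by (simp add: \<phi>_vals eq_commute del: One_nat_def)
  then have "embedding \<phi> claw_2K2 G"
    unfolding embedding_def verts_claw_2K2 edges_claw_2K2 using assms V
    by (simp add: \<phi>_vals insert_commute del: One_nat_def)
  moreover
  have "distinct (map (\<lambda>e. c (\<phi> ` e)) [{Inl (0,0), Inl (0,1)}, {Inl (1,0), Inl (1,1)},
      {Inr (Inl 0), Inr (Inr 0)}, {Inr (Inl 0), Inr (Inr 1)}, {Inr (Inl 0), Inr (Inr 2)}])"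
    using assms(8) by (simp add: \<phi>_vals insert_commute eq_commute del: One_nat_def)
  then have "inj_on (\<lambda>e. c (\<phi> ` e)) (edges claw_2K2)"
    by (simp only: distinct_map edges_claw_2K2 list.set)
  ultimately show ?thesis
    by (auto simp: rainbow_copy_def)
qed

section \<open>Complete bipartite graphs and highly connected subgraphs\<close>

abbreviation (input) K where "K s t \<equiv> complete_bipartite s t"

lemma simple_complete_bipartite: "simple_graph (K s t)"
  by (auto simp: simple_graph_def complete_bipartite_def)

lemma card_verts_complete_bipartite: "card (verts (K s t)) = s + t"
  by (simp add: complete_bipartite_def card_Plus)

text \<open>The predicate \<^term>\<open>isl\<close> tells the two sides apart, so that arguments about a vertex on either
  side need no case distinction.\<close>

lemma edge_complete_bipartite_iff:
  "{u, w} \<in> edges (K s t) \<longleftrightarrow> u \<in> verts (K s t) \<and> w \<in> verts (K s t) \<and> isl u \<noteq> isl w"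
  by (cases u; cases w) (auto simp: complete_bipartite_def doubleton_eq_iff)

lemma edge_complete_bipartiteE:
  assumes "e \<in> edges (K s t)"
  obtains x y where "e = {x, y}" "x \<in> verts (K s t)" "y \<in> verts (K s t)" "isl x" "\<not> isl y"
proof -
  from assms obtain i j where "e = {Inl i, Inr j}" "i < s" "j < t"
    by (auto simp: complete_bipartite_def)
  then show thesis
    by (intro that[of "Inl i" "Inr j"]) (auto simp: complete_bipartite_def)
qed

lemma card_verts_side:
  "card {v \<in> verts (K s t). isl v} = s" "card {v \<in> verts (K s t). \<not> isl v} = t"
proof -
  have "{v \<in> verts (K s t). isl v} = Inl ` {..<s}" "{v \<in> verts (K s t). \<not> isl v} = Inr ` {..<t}"
    by (auto simp: complete_bipartite_def)
  then show "card {v \<in> verts (K s t). isl v} = s" "card {v \<in> verts (K s t). \<not> isl v} = t"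
    by (simp_all add: card_image)
qed

text \<open>The set \<open>D\<close> consists of hubs: each vertex sends edges of colour \<open>a\<close> to all hubs on the other side
  except perhaps one. Two vertices on the same side exclude at most two of the three hubs opposite to them and
  so have a common neighbour; a vertex is joined to the other side by stepping to a hub first.\<close>

lemma connected_of_hubs:
  fixes a :: nat
  assumes W: "W \<subseteq> verts (K s t)"
    and D: "D \<subseteq> W" "3 \<le> card {d \<in> D. isl d}" "3 \<le> card {d \<in> D. \<not> isl d}"
    and hub: "\<And>w. w \<in> W \<Longrightarrow> \<exists>z. \<forall>d\<in>D. isl d \<noteq> isl w \<longrightarrow> d \<noteq> z \<longrightarrow> c {w, d} = a"
  shows "connected_graph (UGraph W {e \<in> edges (K s t). e \<subseteq> W \<and> c e = a})"
proof -
  let ?R = "{(x, y). {x, y} \<in> {e \<in> edges (K s t). e \<subseteq> W \<and> c e = a}}"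
  have step: "(u, v) \<in> ?R" "(v, u) \<in> ?R" if "u \<in> W" "v \<in> W" "isl u \<noteq> isl v" "c {u, v} = a" for u v
    using that W by (auto simp: edge_complete_bipartite_iff insert_commute)
  have big: "3 \<le> card {d \<in> D. isl d \<noteq> q}" for q
    using D(2,3) by (cases q) simp_all
  have ex: "\<exists>d\<in>D. isl d \<noteq> q \<and> d \<noteq> z \<and> d \<noteq> z'" for q z z'
  proof (rule ccontr)
    assume "\<not> ?thesis"
    then have "{d \<in> D. isl d \<noteq> q} \<subseteq> {z, z'}" by auto
    then have "card {d \<in> D. isl d \<noteq> q} \<le> card {z, z'}" by (intro card_mono) auto
    also have "\<dots> \<le> 2" by (simp add: card_insert_if)
    finally show False using big[of q] by simp
  qed
  have same: "(u, v) \<in> ?R\<^sup>*" if uv: "u \<in> W" "v \<in> W" "isl u = isl v" for u v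
  proof -
    obtain z where z: "\<forall>d\<in>D. isl d \<noteq> isl u \<longrightarrow> d \<noteq> z \<longrightarrow> c {u, d} = a"
      using hub[OF uv(1)] by blast
    obtain z' where z': "\<forall>d\<in>D. isl d \<noteq> isl v \<longrightarrow> d \<noteq> z' \<longrightarrow> c {v, d} = a"
      using hub[OF uv(2)] by blast
    obtain d where d: "d \<in> D" "isl d \<noteq> isl u" "d \<noteq> z" "d \<noteq> z'"
      using ex[of "isl u" z z'] by blast
    have "(u, d) \<in> ?R" "(d, v) \<in> ?R"
      using step(1)[of u d] step(2)[of v d] d uv z z' D(1) by auto
    then show ?thesis by (meson r_into_rtrancl rtrancl_trans)
  qed
  have "(u, v) \<in> ?R\<^sup>*" if uv: "u \<in> W" "v \<in> W" for u v
  proof (cases "isl u = isl v")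
    case False
    obtain z where z: "\<forall>d\<in>D. isl d \<noteq> isl u \<longrightarrow> d \<noteq> z \<longrightarrow> c {u, d} = a"
      using hub[OF uv(1)] by blast
    obtain d where d: "d \<in> D" "isl d \<noteq> isl u" "d \<noteq> z"
      using ex[of "isl u" z z] by blast
    have "(u, d) \<in> ?R"
      using step(1)[of u d] d uv z D(1) by auto
    moreover have "(d, v) \<in> ?R\<^sup>*"
      using same[of d v] d uv D(1) False by auto
    ultimately show ?thesis by (rule converse_rtrancl_into_rtrancl)
  qed (use same uv in auto)
  moreover have "W \<noteq> {}" using ex[of True] D(1) by blast
  ultimately show ?thesis
    by (simp add: connected_graph_def)
qed

text \<open>Deleting fewer than \<open>k\<close> vertices leaves three hubs on each side.\<close>

lemma k_connected_of_hubs: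
  fixes a :: nat
  assumes W: "W \<subseteq> verts (K s t)"
    and D: "D \<subseteq> W" "k + 2 \<le> card {d \<in> D. isl d}" "k + 2 \<le> card {d \<in> D. \<not> isl d}"
    and hub: "\<And>w. w \<in> W \<Longrightarrow> \<exists>z. \<forall>d\<in>D. isl d \<noteq> isl w \<longrightarrow> d \<noteq> z \<longrightarrow> c {w, d} = a"
  defines "F \<equiv> UGraph W {e \<in> edges (K s t). e \<subseteq> W \<and> c e = a}"
  shows "subgraph F (K s t) \<and> monochromatic c F \<and> k_connected k F \<and> order F = card W"
proof -
  have finV: "finite (verts (K s t))"
    using simple_complete_bipartite by (simp add: simple_graph_def)
  then have finW: "finite W" using W finite_subset by blast
  have "connected_graph (delete_vertices F S)" if S: "S \<subseteq> W" "card S < k" for S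
  proof -
    have finS: "finite S" using S finW finite_subset by blast
    have fin: "finite {d \<in> D. P d}" for P
      using D(1) finW by (auto intro: finite_subset)
    have "3 \<le> card {d \<in> D - S. isl d = q}" for q
    proof -
      have "{d \<in> D - S. isl d = q} = {d \<in> D. isl d = q} - S" by auto
      moreover have "card {d \<in> D. isl d = q} - card S \<le> card ({d \<in> D. isl d = q} - S)"
        using finS by (intro diff_card_le_card_Diff)
      moreover have "k + 2 \<le> card {d \<in> D. isl d = q}"
        using D(2,3) by (cases q) auto
      ultimately show ?thesis using S(2) by simp
    qed
    from this[of True] this[of False]
    have "3 \<le> card {d \<in> D - S. isl d}" "3 \<le> card {d \<in> D - S. \<not> isl d}"
      by simp_all
    moreover have "\<exists>z. \<forall>d\<in>D - S. isl d \<noteq> isl w \<longrightarrow> d \<noteq> z \<longrightarrow> c {w, d} = a" if "w \<in> W - S" for w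
      using hub[of w] that by blast
    ultimately have "connected_graph (UGraph (W - S) {e \<in> edges (K s t). e \<subseteq> W - S \<and> c e = a})"
      using W D(1) by (intro connected_of_hubs[where D = "D - S"]) blast+
    moreover have "delete_vertices F S = UGraph (W - S) {e \<in> edges (K s t). e \<subseteq> W - S \<and> c e = a}"
      by (auto simp: delete_vertices_def F_def)
    ultimately show ?thesis by simp
  qed
  moreover have "k < card W"
  proof -
    have "card {d \<in> D. isl d} \<le> card W"
      using finW D(1) by (intro card_mono) auto
    then show ?thesis using D(2) by simp
  qed
  ultimately have "k_connected k F"
    by (simp add: k_connected_def order_def F_def)
  moreover have "subgraph F (K s t)"
    using W finW simple_complete_bipartite by (auto simp: subgraph_def simple_graph_def F_def)
  ultimately show ?thesis
    by (auto simp: monochromatic_def order_def F_def)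
qed

text \<open>A set avoiding \<open>a\<close> would have to contain all of \<open>J\<close>.\<close>

lemma mem_all_if_meets_three:
  assumes P: "\<And>A. A \<in> P \<Longrightarrow> finite A \<and> card A \<le> 2"
    and meet: "\<And>A B. A \<in> P \<Longrightarrow> B \<in> Q \<Longrightarrow> A \<inter> B \<noteq> {}"
    and J: "3 \<le> card J" "\<And>i. i \<in> J \<Longrightarrow> {i, a} \<in> Q"
    and "A \<in> P"
  shows "a \<in> A"
proof (rule ccontr)
  assume "a \<notin> A"
  then have "J \<subseteq> A"
    using meet[OF \<open>A \<in> P\<close> J(2)] by auto
  then have "card J \<le> card A"
    using P[OF \<open>A \<in> P\<close>] by (intro card_mono) auto
  then show False
    using P[OF \<open>A \<in> P\<close>] J(1) by simp
qed

lemma pair_eq_if_card_le_2: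
  assumes "finite A" "card A \<le> 2" "x \<in> A" "y \<in> A" "x \<noteq> y"
  shows "A = {x, y}"
  using card_seteq[of A "{x, y}"] assms by auto

text \<open>Fix \<open>A \<in> P\<close>. Each colour outside \<open>A\<close> lies in some member of \<open>Q\<close>, which meets \<open>A\<close> and so consists
  of that colour and an element of \<open>A\<close>. By pigeonhole some \<open>a \<in> A\<close> is used three times; then
  \<open>a\<close> belongs to all members of \<open>P\<close>, and, exchanging the roles of the families, to all members of \<open>Q\<close>.
  Seven colours leave five outside \<open>A\<close>, enough for the pigeonhole.\<close>

lemma cross_intersecting_pairs_common_element:
  assumes I: "finite I" "7 \<le> card I"
    and P: "\<And>A. A \<in> P \<Longrightarrow> finite A \<and> card A \<le> 2"
    and Q: "\<And>B. B \<in> Q \<Longrightarrow> finite B \<and> card B \<le> 2"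
    and meet: "\<And>A B. A \<in> P \<Longrightarrow> B \<in> Q \<Longrightarrow> A \<inter> B \<noteq> {}"
    and cover: "I \<subseteq> \<Union>P" "I \<subseteq> \<Union>Q"
  shows "\<exists>a. (\<forall>A\<in>P. a \<in> A) \<and> (\<forall>B\<in>Q. a \<in> B)"
proof -
  have "\<exists>a J. 3 \<le> card J \<and> (\<forall>i\<in>J. {i, a} \<in> Q)"
  proof -
    have "I \<noteq> {}" using I by auto
    then obtain A where A: "A \<in> P" using cover(1) by auto
    let ?J = "\<lambda>a. {i \<in> I - A. {i, a} \<in> Q}"
    have sub: "I - A \<subseteq> (\<Union>a\<in>A. ?J a)"
    proof
      fix i assume i: "i \<in> I - A"
      then obtain B where B: "B \<in> Q" "i \<in> B" using cover(2) by auto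
      then obtain a where "a \<in> A" "a \<in> B" using meet[OF A B(1)] by auto
      moreover then have "B = {i, a}"
        using pair_eq_if_card_le_2[of B i a] Q[OF B(1)] B(2) i by auto
      ultimately show "i \<in> (\<Union>a\<in>A. ?J a)"
        using B(1) i by auto
    qed
    have A2: "finite A" "card A \<le> 2" using P[OF A] by auto
    have "5 \<le> card (I - A)"
      using diff_card_le_card_Diff[OF A2(1), of I] A2(2) I(2) by linarith
    also have "\<dots> \<le> card (\<Union>a\<in>A. ?J a)"
      using I(1) A2(1) sub by (intro card_mono) auto
    also have "\<dots> \<le> (\<Sum>a\<in>A. card (?J a))"
      using A2(1) by (rule card_UN_le)
    finally have *: "5 \<le> (\<Sum>a\<in>A. card (?J a))" .
    have "\<exists>a\<in>A. 3 \<le> card (?J a)"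
    proof (rule ccontr)
      assume "\<not> ?thesis"
      then have "(\<Sum>a\<in>A. card (?J a)) \<le> (\<Sum>a\<in>A. 2)"
        by (intro sum_mono) (auto simp: not_le)
      also have "\<dots> \<le> 4" using A2(2) by simp
      finally show False using * by simp
    qed
    then show ?thesis by blast
  qed
  then obtain a J where J: "3 \<le> card J" "\<And>i. i \<in> J \<Longrightarrow> {i, a} \<in> Q" by auto
  have aP: "a \<in> A" if "A \<in> P" for A
    using mem_all_if_meets_three[OF P meet J that] .
  have J': "{i, a} \<in> P" if i: "i \<in> I - {a}" for i
  proof -
    obtain A where A: "A \<in> P" "i \<in> A" using cover(1) i by auto
    then have "A = {i, a}"
      using pair_eq_if_card_le_2[of A i a] P[OF A(1)] aP[OF A(1)] i by auto
    then show ?thesis using A by simp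
  qed
  have "card I - card {a} \<le> card (I - {a})"
    by (intro diff_card_le_card_Diff) auto
  then have "3 \<le> card (I - {a})" using I(2) by simp
  then have "a \<in> B" if "B \<in> Q" for B
    using mem_all_if_meets_three[OF Q _ _ J' that] meet by (metis inf_commute)
  then show ?thesis using aP by blast
qed

text \<open>Greedy choice: an edge meets at most four edges, counting itself at both ends.\<close>

lemma matching_of_bounded_degree:
  assumes "finite E" "\<And>e. e \<in> E \<Longrightarrow> card e = 2"
    and "\<And>v. card {e \<in> E. v \<in> e} \<le> 2" "4 * n \<le> card E"
  shows "\<exists>M\<subseteq>E. card M = n \<and> pairwise disjnt M"
  using assms
proof (induction n arbitrary: E)
  case 0
  then show ?case by (intro exI[of _ "{}"]) auto
next
  case (Suc n)
  then have "E \<noteq> {}" by auto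
  then obtain e where e: "e \<in> E" by blast
  then obtain u w where uw: "e = {u, w}" "u \<noteq> w"
    using Suc.prems(2) by (meson card_2_iff)
  let ?N = "{f \<in> E. u \<in> f} \<union> {f \<in> E. w \<in> f}"
  let ?E = "E - ?N"
  have "card ?N \<le> card {f \<in> E. u \<in> f} + card {f \<in> E. w \<in> f}"
    by (rule card_Un_le)
  also have "\<dots> \<le> 4"
    using Suc.prems(3)[of u] Suc.prems(3)[of w] by simp
  finally have N: "card ?N \<le> 4" .
  have "card E - card ?N \<le> card ?E"
    using Suc.prems(1) by (intro diff_card_le_card_Diff) auto
  then have "4 * n \<le> card ?E"
    using N Suc.prems(4) by simp
  moreover have "card {f \<in> ?E. v \<in> f} \<le> 2" for v
  proof -
    have "card {f \<in> ?E. v \<in> f} \<le> card {f \<in> E. v \<in> f}"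
      using Suc.prems(1) by (intro card_mono) auto
    then show ?thesis using Suc.prems(3)[of v] by simp
  qed
  ultimately obtain M where M: "M \<subseteq> ?E" "card M = n" "pairwise disjnt M"
    using Suc.IH[of ?E] Suc.prems(1,2) by auto
  have "e \<notin> M" using M(1) uw by auto
  moreover have "finite M" using M(1) Suc.prems(1) by (meson finite_Diff finite_subset)
  moreover have "disjnt e f" if "f \<in> M" for f
    using that M(1) uw by (auto simp: disjnt_def)
  ultimately show ?case
    using M e by (intro exI[of _ "insert e M"]) (auto simp: pairwise_insert disjnt_sym)
qed

section \<open>Colourings without a rainbow copy\<close>

lemma obtain_three:
  assumes "3 \<le> card A"
  obtains x y z where "x \<in> A" "y \<in> A" "z \<in> A" "x \<noteq> y" "x \<noteq> z" "y \<noteq> z"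
proof -
  obtain B where "B \<subseteq> A" "card B = 3"
    using obtain_subset_with_card_n[OF assms] by metis
  then show thesis
    using that by (auto simp: card_3_iff)
qed

lemma obtain_two:
  assumes "2 \<le> card A"
  obtains x y where "x \<in> A" "y \<in> A" "x \<noteq> y"
proof -
  obtain B where "B \<subseteq> A" "card B = 2"
    using obtain_subset_with_card_n[OF assms] by metis
  then show thesis
    using that by (auto simp: card_2_iff)
qed

text \<open>Each vertex and each colour spoils at most one edge of a rainbow matching.\<close>

lemma card_matching_avoiding:
  assumes M: "finite M" "pairwise disjnt M" "inj_on c M" and U: "finite U" and C: "finite C"
  shows "card M \<le> card {e \<in> M. disjnt e U \<and> c e \<notin> C} + (card U + card C)"
proof -
  have 1: "card {e \<in> M. u \<in> e} \<le> 1" for u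
    using M by (auto simp: card_le_Suc0_iff_eq pairwise_def disjnt_def)
  have 2: "card {e \<in> M. c e = a} \<le> 1" for a
    using M by (auto simp: card_le_Suc0_iff_eq inj_on_def)
  let ?M = "{e \<in> M. disjnt e U \<and> c e \<notin> C}"
  let ?A = "\<Union>u\<in>U. {e \<in> M. u \<in> e}" and ?B = "\<Union>a\<in>C. {e \<in> M. c e = a}"
  have "card ?A \<le> (\<Sum>u\<in>U. card {e \<in> M. u \<in> e})"
    by (rule card_UN_le[OF U])
  also have "\<dots> \<le> (\<Sum>u\<in>U. 1)" by (intro sum_mono 1)
  finally have A: "card ?A \<le> card U" by simp
  have "card ?B \<le> (\<Sum>a\<in>C. card {e \<in> M. c e = a})"
    by (rule card_UN_le[OF C])
  also have "\<dots> \<le> (\<Sum>a\<in>C. 1)" by (intro sum_mono 2)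
  finally have B: "card ?B \<le> card C" by simp
  have "card M \<le> card (?M \<union> (?A \<union> ?B))"
    using M(1) U C by (intro card_mono) (auto simp: disjnt_def)
  also have "\<dots> \<le> card ?M + card (?A \<union> ?B)" by (rule card_Un_le)
  also have "\<dots> \<le> card ?M + (card ?A + card ?B)" by (intro add_left_mono card_Un_le)
  finally show ?thesis using A B by linarith
qed

text \<open>The four vertices \<open>v, w1, w2, w3\<close> and the three colours at \<open>v\<close> spoil at most seven edges of the
  matching, so two edges \<open>{x, y}\<close> and \<open>{x', y'}\<close> survive. With the claw at \<open>v\<close> they form the copy of
  \<open>2K\<^sub>2 \<union> K\<^bsub>1,3\<^esub>\<close>. For \<open>2P\<^sub>3\<close>, the edge \<open>{x, y'}\<close> differs in colour from one of the two edges, which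
  gives one rainbow \<open>P\<^sub>3\<close>; of the three edges at \<open>v\<close>, two avoid the colour of \<open>{x, y'}\<close> and give the other.\<close>

lemma rainbow_copies_at_three_coloured_vertex:
  assumes M: "M \<subseteq> edges (K s t)" "pairwise disjnt M" "inj_on c M" "9 \<le> card M"
    and w: "{v, w1} \<in> edges (K s t)" "{v, w2} \<in> edges (K s t)" "{v, w3} \<in> edges (K s t)"
    and col: "distinct [c {v, w1}, c {v, w2}, c {v, w3}]"
  shows "rainbow_copy c two_P3 (K s t)" "rainbow_copy c claw_2K2 (K s t)"
proof -
  let ?U = "{v, w1, w2, w3}" and ?C = "{c {v, w1}, c {v, w2}, c {v, w3}}"
  let ?M = "{e \<in> M. disjnt e ?U \<and> c e \<notin> ?C}"
  have finM: "finite M" using M(4) card.infinite by fastforce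
  have "card ?U \<le> 4" "card ?C \<le> 3"
    by (simp_all add: card_insert_if)
  then have "2 \<le> card ?M"
    using card_matching_avoiding[OF finM M(2,3), of ?U ?C] M(4) by simp
  then obtain e e' where e: "e \<in> ?M" "e' \<in> ?M" "e \<noteq> e'"
    by (rule obtain_two)
  then obtain x y where xy: "e = {x, y}" "x \<in> verts (K s t)" "y \<in> verts (K s t)" "isl x" "\<not> isl y"
    using edge_complete_bipartiteE M(1) by blast
  obtain x' y' where xy': "e' = {x', y'}" "x' \<in> verts (K s t)" "y' \<in> verts (K s t)"
      "isl x'" "\<not> isl y'"
    using edge_complete_bipartiteE M(1) e(2) by blast
  have dis: "e \<inter> e' = {}"
    using e M(2) by (auto simp: pairwise_def disjnt_def)
  have ed: "{x, y} \<in> edges (K s t)" "{x', y'} \<in> edges (K s t)" "{x, y'} \<in> edges (K s t)"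
    using xy xy' by (simp_all add: edge_complete_bipartite_iff)
  have cc: "c {x, y} \<noteq> c {x', y'}"
    using e xy xy' M(3) by (auto simp: inj_on_def)
  have w_dist: "distinct [v, w1, w2, w3]"
    using w col by (auto simp: edge_complete_bipartite_iff)
  have xy_dist: "distinct [x, y, x', y']"
    using xy xy' dis by auto
  have away: "x \<notin> ?U" "y \<notin> ?U" "x' \<notin> ?U" "y' \<notin> ?U" "c {x, y} \<notin> ?C" "c {x', y'} \<notin> ?C"
    using e xy(1) xy'(1) by (auto simp: disjnt_def)
  show "rainbow_copy c claw_2K2 (K s t)"
    by (rule rainbow_claw_2K2I[OF simple_complete_bipartite w ed(1,2)])
      (use w_dist xy_dist away col cc in \<open>simp_all add: eq_commute\<close>)
  have pick: "rainbow_copy c two_P3 (K s t)"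
    if pq: "p \<in> {w1, w2, w3}" "q \<in> {w1, w2, w3}" "p \<noteq> q" "c {v, p} \<noteq> c {x, y'}" "c {v, q} \<noteq> c {x, y'}"
    for p q
  proof -
    have vpq: "{v, p} \<in> edges (K s t)" "{v, q} \<in> edges (K s t)" "c {v, p} \<noteq> c {v, q}"
      using pq w col by auto
    have pq_away: "distinct [v, p, q]" "x \<notin> {v, p, q}" "y \<notin> {v, p, q}" "x' \<notin> {v, p, q}" "y' \<notin> {v, p, q}"
        "c {x, y} \<notin> {c {v, p}, c {v, q}}" "c {x', y'} \<notin> {c {v, p}, c {v, q}}"
      using pq away w_dist by auto
    show ?thesis
    proof (cases "c {x, y'} = c {x, y}")
      case False
      then show ?thesis
        by (intro rainbow_two_P3I[OF simple_complete_bipartite vpq(1,2) ed(1,3)])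
          (use pq_away pq(4,5) xy_dist vpq(3) in \<open>simp_all add: eq_commute\<close>)
    next
      case True
      then have ne: "c {x, y'} \<noteq> c {x', y'}" using cc by simp
      have ed': "{y', x} \<in> edges (K s t)" "{y', x'} \<in> edges (K s t)"
        using ed by (simp_all add: insert_commute)
      show ?thesis
        by (rule rainbow_two_P3I[OF simple_complete_bipartite vpq(1,2) ed'])
          (use ne pq_away pq(4,5) xy_dist vpq(3) in \<open>simp_all add: eq_commute insert_commute\<close>)
    qed
  qed
  show "rainbow_copy c two_P3 (K s t)"
  proof (cases "c {x, y'} = c {v, w1}")
    case True
    then show ?thesis using pick[of w2 w3] w_dist col by auto
  next
    case False
    then show ?thesis using pick[of w1 w2] pick[of w1 w3] w_dist col
      by (cases "c {x, y'} = c {v, w2}") auto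
  qed
qed

text \<open>In a complete bipartite graph with at least three vertices on each side, any two edges are joined
  by a sequence of edges in which consecutive ones are adjacent, and by one in which consecutive ones are
  disjoint. Hence two colours yield both a rainbow \<open>P\<^sub>3\<close> and a rainbow \<open>2K\<^sub>2\<close>.\<close>

lemma all_edges_same_colour:
  assumes R: "R \<subseteq> verts (K s t)" "3 \<le> card {v \<in> R. isl v}" "3 \<le> card {v \<in> R. \<not> isl v}"
    and loc: "(\<forall>v a b. {v, a} \<in> edges (K s t) \<longrightarrow> {v, b} \<in> edges (K s t) \<longrightarrow> {v, a, b} \<subseteq> R \<longrightarrow>
        c {v, a} = c {v, b}) \<or>
      (\<forall>x y x' y'. {x, y} \<in> edges (K s t) \<longrightarrow> {x', y'} \<in> edges (K s t) \<longrightarrow>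
        {x, y, x', y'} \<subseteq> R \<longrightarrow> distinct [x, y, x', y'] \<longrightarrow> c {x, y} = c {x', y'})"
  shows "\<exists>a. \<forall>e\<in>edges (K s t). e \<subseteq> R \<longrightarrow> c e = a"
proof -
  have edge: "{x, y} \<in> edges (K s t)" if "x \<in> R" "y \<in> R" "isl x" "\<not> isl y" for x y
    using that R(1) by (auto simp: edge_complete_bipartite_iff)
  have third: "\<exists>z\<in>R. isl z = q \<and> z \<noteq> x \<and> z \<noteq> y" for q x y
  proof (rule ccontr)
    assume "\<not> ?thesis"
    then have "{v \<in> R. isl v = q} \<subseteq> {x, y}" by auto
    then have "card {v \<in> R. isl v = q} \<le> card {x, y}" by (intro card_mono) auto
    also have "\<dots> \<le> 2" by (simp add: card_insert_if)
    finally show False using R(2,3) by (cases q) auto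
  qed
  have same: "c {x, y} = c {x', y'}"
    if xy: "x \<in> R" "y \<in> R" "isl x" "\<not> isl y" "x' \<in> R" "y' \<in> R" "isl x'" "\<not> isl y'" for x y x' y'
    using loc
  proof
    assume adj: "\<forall>v a b. {v, a} \<in> edges (K s t) \<longrightarrow> {v, b} \<in> edges (K s t) \<longrightarrow> {v, a, b} \<subseteq> R \<longrightarrow>
        c {v, a} = c {v, b}"
    have "c {x, y} = c {x, y'}"
      using adj[rule_format, of x y y'] edge xy by auto
    moreover have "c {y', x} = c {y', x'}"
      using adj[rule_format, of y' x x'] edge[of x y'] edge[of x' y'] xy by (auto simp: insert_commute)
    ultimately show ?thesis by (simp add: insert_commute)
  next
    assume dis: "\<forall>x y x' y'. {x, y} \<in> edges (K s t) \<longrightarrow> {x', y'} \<in> edges (K s t) \<longrightarrow>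
        {x, y, x', y'} \<subseteq> R \<longrightarrow> distinct [x, y, x', y'] \<longrightarrow> c {x, y} = c {x', y'}"
    obtain u where u: "u \<in> R" "isl u" "u \<noteq> x" "u \<noteq> x'" using third[of True x x'] by auto
    obtain w where w: "w \<in> R" "\<not> isl w" "w \<noteq> y" "w \<noteq> y'" using third[of False y y'] by auto
    have "distinct [x, y, u, w]" "distinct [x', y', u, w]"
      using xy u w by auto
    then have "c {x, y} = c {u, w}" "c {x', y'} = c {u, w}"
      using dis[rule_format, of x y u w] dis[rule_format, of x' y' u w] edge xy u w by auto
    then show ?thesis by simp
  qed
  obtain x where x: "x \<in> R" "isl x" using third[of True] by auto
  obtain y where y: "y \<in> R" "\<not> isl y" using third[of False] by auto
  have "c e = c {x, y}" if "e \<in> edges (K s t)" "e \<subseteq> R" for e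
    using edge_complete_bipartiteE[OF that(1)] same that(2) x y by (metis insert_subset)
  then show ?thesis by blast
qed

text \<open>Here \<open>e i\<close> is the chosen edge of colour \<open>i\<close>, and \<open>R\<close> avoids the chosen edges. A vertex on three chosen
  edges whose colours are not \<open>\<alpha>\<close> or \<open>\<beta>\<close>
  is the centre of a rainbow claw, which also contains a rainbow \<open>P\<^sub>3\<close>; together with
  the rainbow \<open>2K\<^sub>2\<close> or \<open>P\<^sub>3\<close> in \<open>R\<close> this is a forbidden copy. So the degrees among these
  \<open>m - 2 \<ge> 4 \<cdot> 9\<close> edges are at most two.\<close>

lemma rainbow_matching_of_two_coloured_rest:
  assumes e: "\<And>i. i \<in> {1..m} \<Longrightarrow> e i \<in> edges (K s t) \<and> c (e i) = i" and m: "38 \<le> m"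
    and R: "R \<inter> \<Union>(e ` {1..m}) = {}" "R \<subseteq> verts (K s t)" "3 \<le> card {v \<in> R. isl v}"
      "3 \<le> card {v \<in> R. \<not> isl v}"
    and nonmono: "\<nexists>a. \<forall>f\<in>edges (K s t). f \<subseteq> R \<longrightarrow> c f = a"
    and free: "\<not> rainbow_copy c two_P3 (K s t) \<or> \<not> rainbow_copy c claw_2K2 (K s t)"
  shows "\<exists>M\<subseteq>edges (K s t). card M = 9 \<and> pairwise disjnt M \<and> inj_on c M"
proof -
  define E where "E \<alpha> \<beta> = e ` ({1..m} - {\<alpha>, \<beta>})" for \<alpha> \<beta>
  have inj: "inj_on c (E \<alpha> \<beta>)" for \<alpha> \<beta>
    using e by (auto simp: E_def inj_on_def)
  have inje: "inj_on e {1..m}"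
    using e by (metis inj_onI)
  have EK: "E \<alpha> \<beta> \<subseteq> edges (K s t)" for \<alpha> \<beta>
    using e by (auto simp: E_def)
  have avoid: "f \<inter> R = {}" "c f \<noteq> \<alpha> \<and> c f \<noteq> \<beta>" if "f \<in> E \<alpha> \<beta>" for f \<alpha> \<beta>
    using that R(1) e by (auto simp: E_def)
  have star: "\<exists>p q r. {u, p} \<in> E \<alpha> \<beta> \<and> {u, q} \<in> E \<alpha> \<beta> \<and> {u, r} \<in> E \<alpha> \<beta> \<and> distinct [u, p, q, r] \<and>
      distinct [c {u, p}, c {u, q}, c {u, r}]"
    if three: "3 \<le> card {f \<in> E \<alpha> \<beta>. u \<in> f}" for u \<alpha> \<beta>
  proof -
    obtain f g h where fgh: "f \<in> {f \<in> E \<alpha> \<beta>. u \<in> f}" "g \<in> {f \<in> E \<alpha> \<beta>. u \<in> f}" "h \<in> {f \<in> E \<alpha> \<beta>. u \<in> f}"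
        "f \<noteq> g" "f \<noteq> h" "g \<noteq> h"
      using three by (rule obtain_three)
    have other: "\<exists>p. p \<noteq> u \<and> f' = {u, p}" if f': "f' \<in> {f \<in> E \<alpha> \<beta>. u \<in> f}" for f'
    proof -
      obtain y z where "f' = {y, z}" "y \<noteq> z"
        using simple_graph_edge(2)[OF simple_complete_bipartite, of f' s t] f' EK[of \<alpha> \<beta>]
        by (auto simp: card_2_iff)
      then show ?thesis using f' by auto
    qed
    obtain p where p: "p \<noteq> u" "f = {u, p}" using other[OF fgh(1)] by blast
    obtain q where q: "q \<noteq> u" "g = {u, q}" using other[OF fgh(2)] by blast
    obtain r where r: "r \<noteq> u" "h = {u, r}" using other[OF fgh(3)] by blast
    have "c f \<noteq> c g" "c f \<noteq> c h" "c g \<noteq> c h"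
      using fgh inj_onD[OF inj[of \<alpha> \<beta>], of f g] inj_onD[OF inj[of \<alpha> \<beta>], of f h]
        inj_onD[OF inj[of \<alpha> \<beta>], of g h] by auto
    then show ?thesis
      using fgh unfolding p(2) q(2) r(2)
      by (intro exI[of _ p] exI[of _ q] exI[of _ r]) (use p(1) q(1) r(1) in auto)
  qed
  have "\<exists>\<alpha> \<beta>. \<forall>u. card {f \<in> E \<alpha> \<beta>. u \<in> f} \<le> 2"
    using free
  proof
    assume free: "\<not> rainbow_copy c two_P3 (K s t)"
    \<comment> \<open>a rainbow \<open>P\<^sub>3\<close> inside \<open>R\<close> fixes the colours to be left out\<close>
    obtain v a b where v: "{v, a} \<in> edges (K s t)" "{v, b} \<in> edges (K s t)" "{v, a, b} \<subseteq> R"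
        "c {v, a} \<noteq> c {v, b}"
      using all_edges_same_colour[OF R(2-4), of c] nonmono by blast
    have vab: "distinct [v, a, b]"
      using v by (auto simp: edge_complete_bipartite_iff)
    have "card {f \<in> E (c {v, a}) (c {v, b}). u \<in> f} \<le> 2" for u
    proof (rule ccontr)
      assume "\<not> ?thesis"
      then obtain p q r where p: "{u, p} \<in> E (c {v, a}) (c {v, b})" "{u, q} \<in> E (c {v, a}) (c {v, b})"
          "distinct [u, p, q, r]" "distinct [c {u, p}, c {u, q}, c {u, r}]"
        using star[of "c {v, a}" "c {v, b}" u] by auto
      have "rainbow_copy c two_P3 (K s t)"
        by (rule rainbow_two_P3I[OF simple_complete_bipartite v(1,2) subsetD[OF EK p(1)] subsetD[OF EK p(2)]])
          (use avoid(1)[OF p(1)] avoid(1)[OF p(2)] avoid(2)[OF p(1)] avoid(2)[OF p(2)] p(3,4) v(3,4) vab in auto)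
      then show False using free by simp
    qed
    then show ?thesis by blast
  next
    assume free: "\<not> rainbow_copy c claw_2K2 (K s t)"
    \<comment> \<open>here a rainbow \<open>2K\<^sub>2\<close> inside \<open>R\<close> does\<close>
    obtain x y x' y' where v: "{x, y} \<in> edges (K s t)" "{x', y'} \<in> edges (K s t)" "{x, y, x', y'} \<subseteq> R"
        "distinct [x, y, x', y']" "c {x, y} \<noteq> c {x', y'}"
      using all_edges_same_colour[OF R(2-4), of c] nonmono by blast
    have "card {f \<in> E (c {x, y}) (c {x', y'}). u \<in> f} \<le> 2" for u
    proof (rule ccontr)
      assume "\<not> ?thesis"
      then obtain p q r where p: "{u, p} \<in> E (c {x, y}) (c {x', y'})" "{u, q} \<in> E (c {x, y}) (c {x', y'})"
          "{u, r} \<in> E (c {x, y}) (c {x', y'})"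
          "distinct [u, p, q, r]" "distinct [c {u, p}, c {u, q}, c {u, r}]"
        using star[of "c {x, y}" "c {x', y'}" u] by auto
      have "rainbow_copy c claw_2K2 (K s t)"
        by (rule rainbow_claw_2K2I[OF simple_complete_bipartite subsetD[OF EK p(1)] subsetD[OF EK p(2)]
              subsetD[OF EK p(3)] v(1,2)])
          (use avoid(1)[OF p(1)] avoid(1)[OF p(2)] avoid(1)[OF p(3)] avoid(2)[OF p(1)] avoid(2)[OF p(2)]
            avoid(2)[OF p(3)] p(4,5) v(3-5) in auto)
      then show False using free by simp
    qed
    then show ?thesis by blast
  qed
  then obtain \<alpha> \<beta> where deg: "\<And>u. card {f \<in> E \<alpha> \<beta>. u \<in> f} \<le> 2" by auto
  have "card (E \<alpha> \<beta>) = card ({1..m} - {\<alpha>, \<beta>})"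
    unfolding E_def using inje by (intro card_image) (auto intro: inj_on_subset)
  moreover have "card {1..m} - card {\<alpha>, \<beta>} \<le> card ({1..m} - {\<alpha>, \<beta>})"
    by (intro diff_card_le_card_Diff) auto
  moreover have "card {\<alpha>, \<beta>} \<le> 2" by (simp add: card_insert_if)
  ultimately have "4 * 9 \<le> card (E \<alpha> \<beta>)" using m by simp
  moreover have "finite (E \<alpha> \<beta>)" by (simp add: E_def)
  moreover have "card f = 2" if "f \<in> E \<alpha> \<beta>" for f
    using simple_graph_edge(2)[OF simple_complete_bipartite subsetD[OF EK that]] .
  ultimately obtain M where M: "M \<subseteq> E \<alpha> \<beta>" "card M = 9" "pairwise disjnt M"
    using matching_of_bounded_degree[of "E \<alpha> \<beta>" 9] deg by blast
  then show ?thesis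
    using subset_trans[OF M(1) EK] inj_on_subset[OF inj M(1)] by blast
qed

text \<open>Let \<open>L v\<close> be the set of colours at \<open>v\<close>. The sets \<open>L v\<close> on the two sides cross-intersect in the colours
  of the edges, so they share a colour \<open>\<alpha>\<close>. The hubs are vertices \<open>x i\<close> and \<open>y i\<close> on the two sides with
  \<open>L (x i) = L (y i) = {\<alpha>, i}\<close>. A vertex with \<open>L w \<subseteq> {\<alpha>, j}\<close> can have an edge of
  another colour only to the hub of index \<open>j\<close>.\<close>

lemma monochromatic_of_locally_two_coloured:
  assumes surj: "{1..m} \<subseteq> c ` edges (K s t)" and m: "7 \<le> m" "k + 3 \<le> m"
    and two: "\<And>v. v \<in> verts (K s t) \<Longrightarrow>
      card ((\<lambda>w. c {v, w}) ` {w \<in> verts (K s t). isl w \<noteq> isl v}) \<le> 2"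
  shows "\<exists>F. subgraph F (K s t) \<and> monochromatic c F \<and> k_connected k F \<and> order F = s + t"
proof -
  let ?V = "verts (K s t)"
  define L where "L v = (\<lambda>w. c {v, w}) ` {w \<in> ?V. isl w \<noteq> isl v}" for v
  have finV: "finite ?V"
    using simple_complete_bipartite by (simp add: simple_graph_def)
  have L: "finite (L v)" "card (L v) \<le> 2" if "v \<in> ?V" for v
    using finV two[OF that] by (auto simp: L_def)
  have cL: "c {v, w} \<in> L v" "c {v, w} \<in> L w" if "v \<in> ?V" "w \<in> ?V" "isl v \<noteq> isl w" for v w
    using that by (auto simp: L_def insert_commute)
  have ends: "\<exists>x y. x \<in> ?V \<and> isl x \<and> i \<in> L x \<and> y \<in> ?V \<and> \<not> isl y \<and> i \<in> L y"
    if i: "i \<in> {1..m}" for i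
  proof -
    obtain f where f: "f \<in> edges (K s t)" "c f = i" using surj i by auto
    obtain x y where "f = {x, y}" "x \<in> ?V" "y \<in> ?V" "isl x" "\<not> isl y"
      using edge_complete_bipartiteE[OF f(1)] .
    then show ?thesis using cL[of x y] f(2) by auto
  qed
  have "\<exists>a. (\<forall>A \<in> L ` {v \<in> ?V. isl v}. a \<in> A) \<and> (\<forall>B \<in> L ` {v \<in> ?V. \<not> isl v}. a \<in> B)"
  proof (rule cross_intersecting_pairs_common_element[of "{1..m}"])
    show "A \<inter> B \<noteq> {}" if "A \<in> L ` {v \<in> ?V. isl v}" "B \<in> L ` {v \<in> ?V. \<not> isl v}" for A B
      using that cL by blast
    show "{1..m} \<subseteq> \<Union> (L ` {v \<in> ?V. isl v})" "{1..m} \<subseteq> \<Union> (L ` {v \<in> ?V. \<not> isl v})"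
      using ends by blast+
  qed (use m L in auto)
  then obtain \<alpha> where "\<forall>A \<in> L ` {v \<in> ?V. isl v}. \<alpha> \<in> A" "\<forall>B \<in> L ` {v \<in> ?V. \<not> isl v}. \<alpha> \<in> B"
    by (elim exE conjE)
  then have \<alpha>: "\<alpha> \<in> L v" if "v \<in> ?V" for v
    using that by (cases "isl v") auto
  define J where "J = {1..m} - {\<alpha>}"
  have "\<forall>i\<in>J. \<exists>x y. x \<in> ?V \<and> isl x \<and> i \<in> L x \<and> y \<in> ?V \<and> \<not> isl y \<and> i \<in> L y"
    using ends by (auto simp: J_def)
  then obtain x y where xy: "\<And>i. i \<in> J \<Longrightarrow> x i \<in> ?V \<and> isl (x i) \<and> i \<in> L (x i) \<and>
      y i \<in> ?V \<and> \<not> isl (y i) \<and> i \<in> L (y i)"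
    by metis
  have Lxy: "L (x i) = {\<alpha>, i}" "L (y i) = {\<alpha>, i}" if "i \<in> J" for i
    using xy[OF that] that pair_eq_if_card_le_2[OF L(1,2), of _ \<alpha> i] \<alpha> by (simp_all add: J_def)
  have inj: "inj_on f J" if "\<And>i. i \<in> J \<Longrightarrow> L (f i) = {\<alpha>, i}" for f
  proof (rule inj_onI)
    fix i j assume "i \<in> J" "j \<in> J" "f i = f j"
    then have "{\<alpha>, i} = {\<alpha>, j}" using that by metis
    then show "i = j" by (auto simp: doubleton_eq_iff)
  qed
  have "card {1..m} - card {\<alpha>} \<le> card J"
    unfolding J_def by (intro diff_card_le_card_Diff) auto
  then have J: "k + 2 \<le> card J" using m by simp
  let ?D = "x ` J \<union> y ` J"
  have "{d \<in> ?D. isl d} = x ` J" "{d \<in> ?D. \<not> isl d} = y ` J"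
    using xy by auto
  then have D: "k + 2 \<le> card {d \<in> ?D. isl d}" "k + 2 \<le> card {d \<in> ?D. \<not> isl d}"
    using J inj[of x] inj[of y] Lxy by (simp_all add: card_image)
  have hub: "\<exists>z. \<forall>d\<in>?D. isl d \<noteq> isl w \<longrightarrow> d \<noteq> z \<longrightarrow> c {w, d} = \<alpha>" if w: "w \<in> ?V" for w
  proof -
    obtain j where j: "L w \<subseteq> {\<alpha>, j}"
      using pair_eq_if_card_le_2[OF L[OF w] \<alpha>[OF w]] by (metis insertI1 insertI2 subsetI)
    have "c {w, d} = \<alpha>" if d: "d \<in> ?D" "isl d \<noteq> isl w" "d \<noteq> (if isl w then y j else x j)" for d
    proof -
      obtain i where i: "i \<in> J" "d = x i \<or> d = y i" using d(1) by auto
      then have "L d = {\<alpha>, i}" "d \<in> ?V" using Lxy xy by auto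
      moreover have "i \<noteq> j" using i d(2,3) xy[OF i(1)] by auto
      ultimately show ?thesis
        using cL[OF w, of d] d(2) j by auto
    qed
    then show ?thesis by blast
  qed
  have "?D \<subseteq> ?V" using xy by auto
  from k_connected_of_hubs[OF subset_refl this D hub] show ?thesis
    unfolding card_verts_complete_bipartite by (rule exI)
qed

text \<open>The bound \<open>38 = 4 \<cdot> 9 + 2\<close> provides a rainbow matching of nine edges, and \<open>k + 3\<close> colours provide \<open>k + 2\<close> hubs
  per side. The \<open>2m\<close> vertices of the chosen edges are the only ones that may be missed.\<close>

lemma large_k_connected_monochromatic_subgraph:
  assumes col: "coloring_using (K s t) m c" and m: "38 \<le> m" "k + 3 \<le> m"
    and st: "2 * m + k + 3 \<le> s" "2 * m + k + 3 \<le> t"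
    and free: "\<not> rainbow_copy c two_P3 (K s t) \<or> \<not> rainbow_copy c claw_2K2 (K s t)"
  shows "\<exists>F. subgraph F (K s t) \<and> monochromatic c F \<and> k_connected k F \<and> s + t \<le> order F + 2 * m"
proof -
  let ?V = "verts (K s t)"
  have finV: "finite ?V"
    using simple_complete_bipartite by (simp add: simple_graph_def)
  have surj: "{1..m} \<subseteq> c ` edges (K s t)"
    using col by (simp add: coloring_using_def)
  then have "\<forall>i\<in>{1..m}. \<exists>f. f \<in> edges (K s t) \<and> c f = i" by force
  then obtain e where e: "\<And>i. i \<in> {1..m} \<Longrightarrow> e i \<in> edges (K s t) \<and> c (e i) = i" by metis
  let ?X = "\<Union>(e ` {1..m})"
  let ?R = "?V - ?X"
  have e2: "card (e i) = 2" if "i \<in> {1..m}" for i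
    using e[OF that] simple_graph_edge(2)[OF simple_complete_bipartite] by blast
  then have finX: "finite ?X" by (auto intro: card_ge_0_finite)
  have "card ?X \<le> (\<Sum>i\<in>{1..m}. card (e i))" by (intro card_UN_le) auto
  also have "\<dots> = 2 * m" using e2 by simp
  finally have X: "card ?X \<le> 2 * m" .
  have R: "card {v \<in> ?V. P v} - 2 * m \<le> card {v \<in> ?R. P v}" for P
  proof -
    have eq: "{v \<in> ?R. P v} = {v \<in> ?V. P v} - ?X" by auto
    show ?thesis
      unfolding eq using diff_card_le_card_Diff[OF finX, of "{v \<in> ?V. P v}"] X by linarith
  qed
  from R[of isl] R[of "\<lambda>v. \<not> isl v"]
  have R': "k + 3 \<le> card {v \<in> ?R. isl v}" "k + 3 \<le> card {v \<in> ?R. \<not> isl v}"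
    using st by (simp_all add: card_verts_side)
  show ?thesis
  proof (cases "\<exists>a. \<forall>f\<in>edges (K s t). f \<subseteq> ?R \<longrightarrow> c f = a")
    case True
    then obtain a where a: "c f = a" if "f \<in> edges (K s t)" "f \<subseteq> ?R" for f by auto
    have "\<exists>z. \<forall>d\<in>?R. isl d \<noteq> isl w \<longrightarrow> d \<noteq> z \<longrightarrow> c {w, d} = a" if "w \<in> ?R" for w
      using that a by (intro exI[of _ w]) (auto simp: edge_complete_bipartite_iff)
    then have "\<exists>F. subgraph F (K s t) \<and> monochromatic c F \<and> k_connected k F \<and> order F = card ?R"
      using k_connected_of_hubs[of ?R s t ?R k c a] R' by fastforce
    moreover have "s + t \<le> card ?R + 2 * m"
      using R[of "\<lambda>_. True"] by (simp only: simp_thms Collect_mem_eq card_verts_complete_bipartite)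
    ultimately show ?thesis by auto
  next
    case False
    have "\<exists>M\<subseteq>edges (K s t). card M = 9 \<and> pairwise disjnt M \<and> inj_on c M"
      by (rule rainbow_matching_of_two_coloured_rest[OF e m(1) _ _ _ _ False free]) (use R' in auto)
    then obtain M where M: "M \<subseteq> edges (K s t)" "card M = 9" "pairwise disjnt M" "inj_on c M" by auto
    have "card ((\<lambda>w. c {v, w}) ` {w \<in> ?V. isl w \<noteq> isl v}) \<le> 2" (is "card ?L \<le> 2")
      if v: "v \<in> ?V" for v
    proof (rule ccontr)
      assume "\<not> ?thesis"
      then have "3 \<le> card ?L" by simp
      then obtain p q r where "p \<in> ?L" "q \<in> ?L" "r \<in> ?L" "p \<noteq> q" "p \<noteq> r" "q \<noteq> r"
        by (rule obtain_three)
      then obtain w1 w2 w3 where w: "{w1, w2, w3} \<subseteq> {w \<in> ?V. isl w \<noteq> isl v}"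
          "distinct [c {v, w1}, c {v, w2}, c {v, w3}]"
        by auto
      then have "{v, w1} \<in> edges (K s t)" "{v, w2} \<in> edges (K s t)" "{v, w3} \<in> edges (K s t)"
        using v by (auto simp: edge_complete_bipartite_iff)
      from rainbow_copies_at_three_coloured_vertex[OF M(1,3,4) _ this w(2)] free M(2)
      show False by auto
    qed
    \<comment> \<open>in this case the subgraph even spans\<close>
    from monochromatic_of_locally_two_coloured[OF surj _ m(2) this] m(1) show ?thesis
      by fastforce
  qed
qed

section \<open>Colourings without a large connected monochromatic subgraph\<close>

text \<open>The entry \<open>g i j\<close> is the colour of the edge joining the \<open>i\<close>-th vertex on the left to the \<open>j\<close>-th on the right; the
  descriptions are only meaningful on such edges.\<close>

definition matrix_colouring :: "(nat \<Rightarrow> nat \<Rightarrow> nat) \<Rightarrow> (nat + nat) set \<Rightarrow> nat" where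
  "matrix_colouring g e = g (THE i. Inl i \<in> e) (THE j. Inr j \<in> e)"

lemma matrix_colouring_edge [simp]: "matrix_colouring g {Inl i, Inr j} = g i j"
  by (simp add: matrix_colouring_def)

lemma vertex_on_edge_if_1_connected:
  assumes "k_connected 1 F" "v \<in> verts F"
  obtains w where "{v, w} \<in> edges F"
proof -
  have "connected_graph (delete_vertices F {})"
    using assms(1) unfolding k_connected_def by (metis card.empty empty_subsetI zero_less_one)
  moreover have "delete_vertices F {} = F"
    by (cases F) (simp add: delete_vertices_def)
  ultimately have conn: "(v, u) \<in> {(x, y). {x, y} \<in> edges F}\<^sup>*" if "u \<in> verts F" for u
    using assms(2) that by (simp add: connected_graph_def)
  have "\<not> verts F \<subseteq> {v}"
  proof
    assume "verts F \<subseteq> {v}"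
    then have "card (verts F) \<le> card {v}" by (intro card_mono) auto
    then show False using assms(1) by (simp add: k_connected_def order_def)
  qed
  then obtain u where "u \<in> verts F" "u \<noteq> v" by auto
  with conn[of u] that show thesis by (auto elim: converse_rtranclE)
qed

text \<open>Connectivity enters only through the absence of isolated vertices: a connected monochromatic graph
  of colour \<open>a\<close> avoids every set \<open>Z a\<close> of vertices that are not on any edge of colour \<open>a\<close>.\<close>

lemma monochromatic_misses_vertices:
  assumes F: "subgraph F (K s t)" "monochromatic c F" "k_connected 1 F"
    and Z: "\<And>a. Z a \<subseteq> verts (K s t)" "\<And>a. f < card (Z a)"
      "\<And>a e. e \<in> edges (K s t) \<Longrightarrow> c e = a \<Longrightarrow> e \<inter> Z a = {}"
  shows "order F + f < s + t"
proof -
  have "verts F \<noteq> {}" using F(3) by (auto simp: k_connected_def order_def)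
  then obtain v w where vw: "{v, w} \<in> edges F"
    using vertex_on_edge_if_1_connected[OF F(3)] by blast
  let ?Z = "Z (c {v, w})"
  have finV: "finite (verts (K s t))"
    using simple_complete_bipartite by (simp add: simple_graph_def)
  have "u \<in> verts (K s t) - ?Z" if u: "u \<in> verts F" for u
  proof
    obtain u' where u': "{u, u'} \<in> edges F"
      using vertex_on_edge_if_1_connected[OF F(3) u] .
    then have "{u, u'} \<in> edges (K s t)"
      using F(1) unfolding subgraph_def by (elim conjE) (rule subsetD)
    moreover have "c {u, u'} = c {v, w}"
      by (rule F(2)[unfolded monochromatic_def, rule_format, OF u' vw])
    ultimately have "{u, u'} \<inter> ?Z = {}" by (rule Z(3))
    then show "u \<notin> ?Z" by simp
    show "u \<in> verts (K s t)"
      using F(1) u unfolding subgraph_def by (elim conjE) (rule subsetD)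
  qed
  then have "verts F \<subseteq> verts (K s t) - ?Z"
    by (rule subsetI)
  then have "order F \<le> card (verts (K s t) - ?Z)"
    using finV unfolding order_def by (intro card_mono) simp_all
  also have "\<dots> = s + t - card ?Z"
    using card_Diff_subset[OF finite_subset[OF Z(1) finV] Z(1)]
    by (simp only: card_verts_complete_bipartite)
  finally have "order F \<le> s + t - card ?Z" .
  moreover have "card ?Z \<le> s + t"
    using card_mono[OF finV Z(1)] by (simp add: card_verts_complete_bipartite)
  ultimately show ?thesis using Z(2)[of "c {v, w}"] by linarith
qed

text \<open>Of two consecutive numbers, at least one has the wrong residue.\<close>

lemma card_other_residues:
  fixes p :: nat
  assumes "2 \<le> p"
  shows "f < card {i \<in> {m..<m + 2 * Suc f + n}. Suc (i mod p) \<noteq> a}" (is "_ < card ?A")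
proof -
  let ?h = "\<lambda>q. if Suc ((m + 2 * q) mod p) \<noteq> a then m + 2 * q else Suc (m + 2 * q)"
  have "Suc (Suc i mod p) \<noteq> a" if "Suc (i mod p) = a" for i
    using assms that by (auto simp: mod_Suc)
  then have "?h ` {..f} \<subseteq> ?A" by auto
  moreover have "inj_on ?h {..f}"
    by (auto simp: inj_on_def split: if_splits)
  ultimately have "card {..f} \<le> card ?A"
    by (intro card_inj_on_le[of ?h]) auto
  then show ?thesis by simp
qed

text \<open>The rows from \<open>m\<close> on are each monochromatic, in \<open>p \<ge> 2\<close> colours that alternate, so each colour misses as many
  rows as desired. Only these rows grow in number with \<open>s\<close>, so the rows above may be coloured at will, as long as the
  first \<open>m\<close> rows and columns show all colours. Already \<open>k = 1\<close> is contradicted.\<close>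

lemma class_B_rainbow_copy:
  assumes "H \<in> class_B"
  obtains m\<^sub>0 where "\<And>m p g. m\<^sub>0 \<le> m \<Longrightarrow> 2 \<le> p \<Longrightarrow> (\<And>i j. m \<le> i \<Longrightarrow> g i j = Suc (i mod p)) \<Longrightarrow>
      (\<And>i j. g i j \<in> {1..m}) \<Longrightarrow> (\<And>a. a \<in> {1..m} \<Longrightarrow> \<exists>i<m. \<exists>j<m. g i j = a) \<Longrightarrow>
      \<exists>s t. rainbow_copy (matrix_colouring g) H (K s t)"
proof -
  have H: "simple_graph H" using assms by (simp add: class_B_def)
  obtain m\<^sub>0 where m\<^sub>0: "\<And>m. max m\<^sub>0 (card (edges H)) \<le> m \<Longrightarrow> \<exists>N\<^sub>0 f. \<forall>s t. min s t \<ge> N\<^sub>0 \<longrightarrow>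
       (\<forall>c. coloring_using (K s t) m c \<and> rainbow_free H (K s t) c \<longrightarrow>
          (\<exists>F. subgraph F (K s t) \<and> monochromatic c F \<and> k_connected 1 F \<and> s + t \<le> order F + f))"
    using assms unfolding class_B_def by blast
  have copy: "\<exists>s t. rainbow_copy (matrix_colouring g) H (K s t)"
    if m: "max m\<^sub>0 (card (edges H)) \<le> m" and p: "2 \<le> p" and tail: "\<And>i j. m \<le> i \<Longrightarrow> g i j = Suc (i mod p)"
      and range: "\<And>i j. g i j \<in> {1..m}" and surj: "\<And>a. a \<in> {1..m} \<Longrightarrow> \<exists>i<m. \<exists>j<m. g i j = a"
    for m p :: nat and g
  proof -
    obtain N\<^sub>0 f where N\<^sub>0: "\<And>s t c. N\<^sub>0 \<le> min s t \<Longrightarrow> coloring_using (K s t) m c \<Longrightarrow>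
        rainbow_free H (K s t) c \<Longrightarrow>
        \<exists>F. subgraph F (K s t) \<and> monochromatic c F \<and> k_connected 1 F \<and> s + t \<le> order F + f"
      using m\<^sub>0[OF m] by blast
    let ?s = "m + 2 * Suc f + N\<^sub>0" and ?c = "matrix_colouring g"
    let ?Z = "\<lambda>a. Inl ` {i \<in> {m..<?s}. Suc (i mod p) \<noteq> a}"
    have edge: "\<exists>i j. i < ?s \<and> j < ?s \<and> e = {Inl i, Inr j}" if "e \<in> edges (K ?s ?s)" for e
      using that by (auto simp: complete_bipartite_def)
    have edge': "{Inl i, Inr j} \<in> edges (K ?s ?s)" if "i < ?s" "j < ?s" for i j
      using that by (auto simp: complete_bipartite_def)
    have col: "coloring_using (K ?s ?s) m ?c"
      unfolding coloring_using_def
    proof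
      show "?c ` edges (K ?s ?s) \<subseteq> {1..m}"
      proof (rule image_subsetI)
        fix e assume "e \<in> edges (K ?s ?s)"
        then obtain i j where "e = {Inl i, Inr j}" using edge by blast
        then show "?c e \<in> {1..m}" using range[of i j] by simp
      qed
      show "{1..m} \<subseteq> ?c ` edges (K ?s ?s)"
      proof
        fix a assume "a \<in> {1..m}"
        then obtain i j where ij: "i < m" "j < m" "g i j = a" using surj by blast
        show "a \<in> ?c ` edges (K ?s ?s)"
          using ij edge'[of i j] by (intro image_eqI[of _ _ "{Inl i, Inr j}"]) auto
      qed
    qed
    have "\<not> rainbow_free H (K ?s ?s) ?c"
    proof
      assume "rainbow_free H (K ?s ?s) ?c"
      then obtain F where F: "subgraph F (K ?s ?s)" "monochromatic ?c F" "k_connected 1 F"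
          "?s + ?s \<le> order F + f"
        using N\<^sub>0[OF _ col] by auto
      have Z1: "?Z a \<subseteq> verts (K ?s ?s)" for a
        by (auto simp: complete_bipartite_def)
      have Z2: "f < card (?Z a)" for a
        using card_other_residues[OF p] by (simp add: card_image)
      have Z3: "e \<inter> ?Z a = {}" if e: "e \<in> edges (K ?s ?s)" "?c e = a" for e a
      proof -
        obtain i j where ij: "e = {Inl i, Inr j}" using edge[OF e(1)] by blast
        then have "g i j = a" using e(2) by simp
        then show ?thesis using tail[of i j] ij by auto
      qed
      have "order F + f < ?s + ?s"
        by (rule monochromatic_misses_vertices[OF F(1-3), of ?Z]) (fact Z1 Z2 Z3)+
      then show False using F(4) by simp
    qed
    then show ?thesis
      using rainbow_free_iff[OF H] by blast
  qed
  show thesis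
    by (rule that) (rule copy)
qed

lemma embedded_edgeE:
  assumes "simple_graph H" "embedding \<phi> H (K s t)" "e \<in> edges H"
  obtains u w i j where "e = {u, w}" "u \<in> verts H" "w \<in> verts H" "\<phi> u = Inl i" "\<phi> w = Inr j"
proof -
  obtain a b where ab: "e = {a, b}" using simple_graph_edge(2)[OF assms(1,3)] by (auto simp: card_2_iff)
  have V: "a \<in> verts H" "b \<in> verts H" using simple_graph_edge(1)[OF assms(1,3)] ab by auto
  have "{\<phi> a, \<phi> b} \<in> edges (K s t)"
    using assms(2,3) ab by (auto simp: embedding_def)
  then have "isl (\<phi> a) \<noteq> isl (\<phi> b)" by (simp add: edge_complete_bipartite_iff)
  then show thesis
    using that[of a b] that[of b a] ab V by (cases "\<phi> a"; cases "\<phi> b") (auto simp: insert_commute)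
qed

text \<open>In a rainbow subgraph of a colouring by rows, each vertex on the left lies on one edge only; these
  vertices are the leaves, the others the centres.\<close>

lemma star_forest_of_stripes:
  assumes H: "simple_graph H" "no_isolated_vertices H"
    and copy: "rainbow_copy (matrix_colouring (\<lambda>i j. h i)) H (K s t)"
  shows "\<exists>L ctr. ctr ` L \<inter> L = {} \<and> edges H = (\<lambda>l. {l, ctr l}) ` L \<and> verts H = L \<union> ctr ` L"
proof -
  obtain \<phi> where \<phi>: "embedding \<phi> H (K s t)"
      and inj: "inj_on (\<lambda>e. matrix_colouring (\<lambda>i j. h i) (\<phi> ` e)) (edges H)"
    using copy by (auto simp: rainbow_copy_def)
  define L where "L = {v \<in> verts H. isl (\<phi> v)}"
  have split: "\<exists>u w. e = {u, w} \<and> u \<in> L \<and> w \<in> verts H - L" if e: "e \<in> edges H" for e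
  proof -
    obtain u w i j where "e = {u, w}" "u \<in> verts H" "w \<in> verts H" "\<phi> u = Inl i" "\<phi> w = Inr j"
      using embedded_edgeE[OF H(1) \<phi> e] .
    then show ?thesis by (intro exI[of _ u] exI[of _ w]) (simp add: L_def)
  qed
  have uniq: "e = e'" if e: "e \<in> edges H" "e' \<in> edges H" "l \<in> e" "l \<in> e'" "l \<in> L" for e e' l
  proof -
    obtain u w i j where 1: "e = {u, w}" "\<phi> u = Inl i" "\<phi> w = Inr j"
      using embedded_edgeE[OF H(1) \<phi> e(1)] by metis
    obtain u' w' i' j' where 2: "e' = {u', w'}" "\<phi> u' = Inl i'" "\<phi> w' = Inr j'"
      using embedded_edgeE[OF H(1) \<phi> e(2)] by metis
    have "l = u" "l = u'" using e(3-5) 1 2 by (auto simp: L_def)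
    then have "i = i'" using 1 2 by simp
    then show ?thesis
      using inj_onD[OF inj _ e(1,2)] 1 2 by simp
  qed
  have "\<forall>l\<in>L. \<exists>w. {l, w} \<in> edges H \<and> w \<in> verts H - L"
  proof
    fix l assume l: "l \<in> L"
    then obtain e where e: "e \<in> edges H" "l \<in> e"
      using H(2) by (auto simp: no_isolated_vertices_def L_def)
    then obtain u w where "e = {u, w}" "u \<in> L" "w \<in> verts H - L" using split by blast
    then show "\<exists>w. {l, w} \<in> edges H \<and> w \<in> verts H - L" using e l by auto
  qed
  then obtain ctr where ctr: "\<And>l. l \<in> L \<Longrightarrow> {l, ctr l} \<in> edges H \<and> ctr l \<in> verts H - L" by metis
  have E: "\<exists>l\<in>L. e = {l, ctr l}" if e: "e \<in> edges H" for e
  proof -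
    obtain u w where "e = {u, w}" "u \<in> L" using split[OF e] by blast
    then show ?thesis using uniq[OF e, of "{u, ctr u}" u] ctr by blast
  qed
  have "v \<in> L \<union> ctr ` L" if v: "v \<in> verts H" for v
  proof -
    obtain e where "e \<in> edges H" "v \<in> e" using H(2) v by (auto simp: no_isolated_vertices_def)
    then show ?thesis using E by blast
  qed
  moreover have "L \<subseteq> verts H" by (auto simp: L_def)
  ultimately show ?thesis
    using ctr E by (intro exI[of _ L] exI[of _ ctr]) blast
qed

lemma card_edges_of_two_colours:
  assumes "inj_on (\<lambda>e. c (\<phi> ` e)) E"
  shows "finite {e \<in> E. c (\<phi> ` e) \<in> {1, 2::nat}}" "card {e \<in> E. c (\<phi> ` e) \<in> {1, 2::nat}} \<le> 2"
proof -
  have inj: "inj_on (\<lambda>e. c (\<phi> ` e)) {e \<in> E. c (\<phi> ` e) \<in> {1, 2}}"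
    using assms by (rule inj_on_subset) auto
  then show "finite {e \<in> E. c (\<phi> ` e) \<in> {1, 2}}"
    by (rule inj_on_finite[where B = "{1, 2}"]) auto
  have "card {e \<in> E. c (\<phi> ` e) \<in> {1, 2}} \<le> card {1, 2::nat}"
    using inj by (rule card_inj_on_le) auto
  then show "card {e \<in> E. c (\<phi> ` e) \<in> {1, 2}} \<le> 2" by simp
qed

text \<open>Outside row \<open>0\<close> only two colours occur, so a rainbow subgraph has at most two edges there.\<close>

lemma star_and_two_edges:
  assumes H: "simple_graph H"
    and g: "\<And>i j. i \<noteq> 0 \<Longrightarrow> g i j \<in> {1, 2}"
    and copy: "rainbow_copy (matrix_colouring g) H (K s t)"
  shows "\<exists>v. card {e \<in> edges H. v \<notin> e} \<le> 2"
proof -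
  obtain \<phi> where \<phi>: "embedding \<phi> H (K s t)"
      and inj: "inj_on (\<lambda>e. matrix_colouring g (\<phi> ` e)) (edges H)"
    using copy by (auto simp: rainbow_copy_def)
  let ?E = "{e \<in> edges H. matrix_colouring g (\<phi> ` e) \<in> {1, 2}}"
  \<comment> \<open>any value will do if the copy avoids row \<open>0\<close>, since then all its edges have one of the two colours\<close>
  let ?v = "inv_into (verts H) \<phi> (Inl 0)"
  have "e \<in> ?E" if e: "e \<in> edges H" "?v \<notin> e" for e
  proof -
    obtain u w i j where 1: "e = {u, w}" "u \<in> verts H" "\<phi> u = Inl i" "\<phi> w = Inr j"
      using embedded_edgeE[OF H \<phi> e(1)] by metis
    have "u = inv_into (verts H) \<phi> (\<phi> u)"
      using \<phi> 1(2) by (simp add: embedding_def)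
    then have "i \<noteq> 0" using e(2) 1 by auto
    then show ?thesis using g[of i j] 1 e(1) by simp
  qed
  then have "card {e \<in> edges H. ?v \<notin> e} \<le> card ?E"
    using card_edges_of_two_colours(1)[OF inj] by (intro card_mono) auto
  then show ?thesis
    using card_edges_of_two_colours(2)[OF inj] by (meson le_trans)
qed

text \<open>Off the diagonal only two colours occur, and the diagonal is a matching.\<close>

lemma matching_and_two_edges:
  assumes H: "simple_graph H"
    and g: "\<And>i j. i \<noteq> j \<Longrightarrow> g i j \<in> {1, 2}"
    and copy: "rainbow_copy (matrix_colouring g) H (K s t)"
  shows "\<exists>D. finite D \<and> card D \<le> 2 \<and> pairwise disjnt (edges H - D)"
proof -
  obtain \<phi> where \<phi>: "embedding \<phi> H (K s t)"
      and inj: "inj_on (\<lambda>e. matrix_colouring g (\<phi> ` e)) (edges H)"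
    using copy by (auto simp: rainbow_copy_def)
  let ?D = "{e \<in> edges H. matrix_colouring g (\<phi> ` e) \<in> {1, 2}}"
  have diag: "\<exists>i. \<phi> ` e = {Inl i, Inr i}" if e: "e \<in> edges H - ?D" for e
  proof -
    obtain u w i j where 1: "e = {u, w}" "\<phi> u = Inl i" "\<phi> w = Inr j"
      using embedded_edgeE[OF H \<phi>] e by (metis DiffD1)
    then show ?thesis using g[of i j] e by auto
  qed
  have "disjnt e e'" if e: "e \<in> edges H - ?D" "e' \<in> edges H - ?D" "e \<noteq> e'" for e e'
  proof -
    obtain i i' where i: "\<phi> ` e = {Inl i, Inr i}" "\<phi> ` e' = {Inl i', Inr i'}"
      using diag[OF e(1)] diag[OF e(2)] by blast
    then have "i \<noteq> i'" using inj_onD[OF inj, of e e'] e by auto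
    then have "\<phi> ` e \<inter> \<phi> ` e' = {}" using i by auto
    then show ?thesis by (auto simp: disjnt_def)
  qed
  then have "pairwise disjnt (edges H - ?D)" by (simp add: pairwise_def)
  then show ?thesis using card_edges_of_two_colours[OF inj] by blast
qed

section \<open>Star forests with few edges outside a star and outside a matching\<close>

text \<open>The leaves are \<open>L\<close>, and \<open>ctr\<close> maps a leaf to its centre. The hypothesis on \<open>v\<close> still holds, up to the
  choice of the vertex, for some centre \<open>x\<close>: if \<open>v\<close> is not a centre, it lies on at most one edge, so the
  forest has at most three edges. Let \<open>A\<close> be the leaves at \<open>x\<close> and \<open>R\<close> the at most two others.
  All but two edges being disjoint, \<open>A\<close> has at most three elements. If the edges at \<open>R\<close> are disjoint, the forest
  embeds into \<open>2K\<^sub>2 \<union> K\<^bsub>1,3\<^esub>\<close>. Otherwise they form a \<open>P\<^sub>3\<close>, which uses up one of the two exceptional edges, so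
  \<open>A\<close> has at most two elements and the forest embeds into \<open>2P\<^sub>3\<close>.\<close>

lemma star_forest_embeds:
  assumes fin: "finite L" and L: "L \<noteq> {}" "ctr ` L \<inter> L = {}"
    and H: "edges H = (\<lambda>l. {l, ctr l}) ` L" "verts H = L \<union> ctr ` L"
    and star: "card {e \<in> edges H. v \<notin> e} \<le> 2"
    and D: "finite D" "card D \<le> 2" "pairwise disjnt (edges H - D)"
  shows "(\<exists>\<phi>. embedding \<phi> H two_P3) \<or> (\<exists>\<phi>. embedding \<phi> H claw_2K2)"
proof -
  let ?ed = "\<lambda>l. {l, ctr l}"
  have inj: "inj_on ?ed L"
    using L(2) by (auto simp: inj_on_def doubleton_eq_iff)
  have "card {l \<in> L. v \<notin> ?ed l} = card (?ed ` {l \<in> L. v \<notin> ?ed l})"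
    using inj by (intro card_image[symmetric]) (auto intro: inj_on_subset)
  also have "?ed ` {l \<in> L. v \<notin> ?ed l} = {e \<in> edges H. v \<notin> e}"
    unfolding H by blast
  finally have star': "card {l \<in> L. v \<notin> ?ed l} \<le> 2" using star by simp
  have "\<exists>l0\<in>L. card {l \<in> L. ctr l \<noteq> ctr l0} \<le> 2"
  proof (cases "v \<in> ctr ` L")
    case True
    then obtain l0 where l0: "l0 \<in> L" "v = ctr l0" by auto
    have "{l \<in> L. ctr l \<noteq> ctr l0} = {l \<in> L. v \<notin> ?ed l}" using l0 L(2) by auto
    then show ?thesis using l0(1) star' by (intro bexI[of _ l0]) (simp_all only:)
  next
    case False
    obtain l0 where l0: "l0 \<in> L" "v \<in> L \<longrightarrow> l0 = v" using L(1) by blast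
    have "card {l \<in> L. ctr l \<noteq> ctr l0} \<le> card (L - {l0})"
      using fin by (intro card_mono) auto
    moreover have "card (L - {l0}) \<le> 2"
    proof (cases "v \<in> L")
      case True
      then have "L - {l0} = {l \<in> L. v \<notin> ?ed l}" using l0 False by auto
      then show ?thesis using star' by (simp only:)
    next
      case v: False
      then have "L = {l \<in> L. v \<notin> ?ed l}" using False by auto
      then have "card L \<le> 2" using star' by (simp only:)
      then show ?thesis using fin by (meson card_Diff1_le le_trans)
    qed
    ultimately show ?thesis using l0(1) by (intro bexI[of _ l0]) simp_all
  qed
  then obtain l0 where l0: "l0 \<in> L" "card {l \<in> L. ctr l \<noteq> ctr l0} \<le> 2" by auto
  define x where "x = ctr l0"
  define A where "A = {l \<in> L. ctr l = x}"
  define R where "R = {l \<in> L. ctr l \<noteq> x}"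
  have R2: "card R \<le> 2" using l0 by (simp add: R_def x_def)
  have finAR: "finite A" "finite R" using fin by (auto simp: A_def R_def)
  have x: "x \<notin> L" "x \<in> ctr ` L" using l0 L(2) by (auto simp: x_def)
  have A: "\<And>l. l \<in> A \<Longrightarrow> l \<in> L \<and> ctr l = x" and R: "\<And>l. l \<in> R \<Longrightarrow> l \<in> L \<and> ctr l \<noteq> x \<and> l \<notin> A"
    by (auto simp: A_def R_def)
  have LAR: "L = A \<union> R" by (auto simp: A_def R_def)
  have VH: "verts H = insert x (A \<union> R \<union> ctr ` R)"
    unfolding H(2) using x(2) by (auto simp: A_def R_def)
  have ctrL: "ctr l \<notin> L" if "l \<in> L" for l using L(2) that by auto
  \<comment> \<open>the edges at \<open>x\<close> pairwise meet, so at most one of them is outside \<open>D\<close>\<close>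
  have cardA: "card A \<le> Suc (card (D \<inter> ?ed ` A))"
  proof -
    have "e = e'" if e: "e \<in> ?ed ` A - D" "e' \<in> ?ed ` A - D" for e e'
    proof (rule ccontr)
      assume "e \<noteq> e'"
      moreover have "e \<in> edges H - D" "e' \<in> edges H - D" using e A by (auto simp: H(1))
      ultimately have "disjnt e e'" using D(3) by (simp add: pairwise_def)
      moreover have "x \<in> e" "x \<in> e'" using e A by auto
      ultimately show False by (auto simp: disjnt_def)
    qed
    then have "card (?ed ` A - D) \<le> 1"
      using finAR(1) by (simp add: card_le_Suc0_iff_eq)
    moreover have "card (?ed ` A) = card A"
      using inj by (intro card_image) (auto simp: A_def intro: inj_on_subset)
    moreover have "card (?ed ` A) = card (?ed ` A \<inter> D) + card (?ed ` A - D)"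
      using finAR(1) by (simp add: card_Int_Diff)
    ultimately show ?thesis by (simp add: Int_commute)
  qed
  show ?thesis
  proof (cases "inj_on ctr R")
    case True
    have "card (D \<inter> ?ed ` A) \<le> card D" using D(1) by (intro card_mono) auto
    then have "card A \<le> card {..<3::nat}" using cardA D(2) by simp
    then obtain g where g: "inj_on g A" "g ` A \<subseteq> {..<3::nat}"
      using inj_on_iff_card_le[OF finAR(1), of "{..<3::nat}"] by auto
    obtain h where h: "inj_on h R" "h ` R \<subseteq> {..<2::nat}"
      using inj_on_iff_card_le[OF finAR(2), of "{..<2::nat}"] R2 by auto
    have g': "g l = 0 \<or> g l = 1 \<or> g l = 2" if "l \<in> A" for l
      using subsetD[OF g(2) imageI[OF that]] by auto
    have h': "h l = 0 \<or> h l = 1" if "l \<in> R" for l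
      using subsetD[OF h(2) imageI[OF that]] by auto
    define \<phi> :: "_ \<Rightarrow> (nat \<times> nat) + (nat + nat)" where
      "\<phi> v = (if v = x then Inr (Inl 0) else if v \<in> A then Inr (Inr (g v))
        else if v \<in> R then Inl (h v, 0) else Inl (h (inv_into R ctr v), 1))" for v
    have vals: "\<phi> x = Inr (Inl 0)" "\<And>l. l \<in> A \<Longrightarrow> \<phi> l = Inr (Inr (g l))"
      "\<And>l. l \<in> R \<Longrightarrow> \<phi> l = Inl (h l, 0)" "\<And>l. l \<in> R \<Longrightarrow> \<phi> (ctr l) = Inl (h l, 1)"
      using A R x ctrL True by (auto simp: \<phi>_def LAR)
    have inj\<phi>: "inj_on \<phi> (verts H)"
      unfolding VH using g(1) h(1) by (auto simp: inj_on_def vals)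
    have img\<phi>: "\<phi> ` verts H \<subseteq> verts claw_2K2"
    proof -
      have "\<phi> l \<in> verts claw_2K2" if "l \<in> A" for l
        unfolding verts_claw_2K2 using g'[OF that] that by (auto simp: vals)
      moreover have "\<phi> l \<in> verts claw_2K2" "\<phi> (ctr l) \<in> verts claw_2K2" if "l \<in> R" for l
        unfolding verts_claw_2K2 using h'[OF that] that by (auto simp: vals)
      moreover have "\<phi> x \<in> verts claw_2K2"
        unfolding verts_claw_2K2 by (simp add: vals)
      ultimately show ?thesis
        unfolding VH by blast
    qed
    have edge\<phi>: "\<phi> ` e \<in> edges claw_2K2" if e: "e \<in> edges H" for e
    proof -
      obtain l where l: "l \<in> A \<or> l \<in> R" "e = {l, ctr l}" using e LAR by (auto simp: H(1))
      from l(1) show ?thesis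
      proof
        assume lA: "l \<in> A"
        have "\<phi> ` e = {Inr (Inl 0), Inr (Inr (g l))}"
          unfolding l(2) using A[OF lA] lA by (simp add: vals insert_commute)
        then show ?thesis
          unfolding edges_claw_2K2 using g'[OF lA] by (elim disjE) simp_all
      next
        assume lR: "l \<in> R"
        have "\<phi> ` e = {Inl (h l, 0), Inl (h l, 1)}"
          unfolding l(2) using lR by (simp add: vals)
        then show ?thesis
          unfolding edges_claw_2K2 using h'[OF lR] by (elim disjE) simp_all
      qed
    qed
    show ?thesis
      by (rule disjI2) (rule exI, rule embeddingI[OF inj\<phi> img\<phi> edge\<phi>])
  next
    case False
    then obtain a b where ab: "a \<in> R" "b \<in> R" "a \<noteq> b" "ctr a = ctr b"
      by (auto simp: inj_on_def)
    have Rab: "R = {a, b}"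
      using pair_eq_if_card_le_2[OF finAR(2) R2 ab(1,2,3)] .
    have "?ed a \<in> D \<or> ?ed b \<in> D"
    proof (rule ccontr)
      assume "\<not> ?thesis"
      then have "?ed a \<in> edges H - D" "?ed b \<in> edges H - D" using ab R by (auto simp: H(1))
      moreover have "?ed a \<noteq> ?ed b" using inj_onD[OF inj, of a b] ab R by blast
      ultimately have "disjnt (?ed a) (?ed b)" by (intro pairwiseD[OF D(3)])
      then show False using ab(4) by (auto simp: disjnt_def)
    qed
    then obtain l where l: "l \<in> R" "?ed l \<in> D" using ab by auto
    have "?ed l \<notin> ?ed ` A"
    proof
      assume "?ed l \<in> ?ed ` A"
      then obtain l' where "l' \<in> A" "?ed l = ?ed l'" by auto
      then show False using inj_onD[OF inj, of l l'] A R[OF l(1)] by auto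
    qed
    then have "D \<inter> ?ed ` A \<subseteq> D - {?ed l}" by auto
    then have "card (D \<inter> ?ed ` A) \<le> card (D - {?ed l})" using D(1) by (intro card_mono) auto
    also have "\<dots> \<le> 1" using l(2) D by simp
    finally have "card A \<le> card {..<2::nat}" using cardA by simp
    then obtain g where g: "inj_on g A" "g ` A \<subseteq> {..<2::nat}"
      using inj_on_iff_card_le[OF finAR(1), of "{..<2::nat}"] by auto
    have g': "g l = 0 \<or> g l = 1" if "l \<in> A" for l
      using subsetD[OF g(2) imageI[OF that]] by auto
    define \<phi> :: "_ \<Rightarrow> nat \<times> nat" where
      "\<phi> v = (if v = x then (0, 1) else if v \<in> A then (0, 2 * g v)
        else if v = a then (1, 0) else if v = b then (1, 2) else (1, 1))" for v
    have "a \<in> L" "b \<in> L" "a \<notin> A" "b \<notin> A" "ctr b \<noteq> x"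
      using R[OF ab(1)] R[OF ab(2)] by simp_all
    moreover have "ctr b \<notin> L" using ctrL \<open>b \<in> L\<close> by simp
    moreover have "A \<subseteq> L" by (simp add: LAR)
    ultimately have sep: "a \<notin> A" "b \<notin> A" "ctr b \<notin> A" "x \<notin> A" "a \<noteq> x" "b \<noteq> x" "ctr b \<noteq> x"
        "ctr b \<noteq> a" "ctr b \<noteq> b"
      using x(1) by auto
    have neq: "l \<noteq> x" if "l \<in> A" for l
      using that sep(4) by blast
    have vals: "\<phi> x = (0, 1)" "\<And>l. l \<in> A \<Longrightarrow> \<phi> l = (0, 2 * g l)"
      "\<phi> a = (1, 0)" "\<phi> b = (1, 2)" "\<phi> (ctr b) = (1, 1)"
      using sep ab(3) neq by (simp_all add: \<phi>_def)
    have VH': "verts H = {x, a, b, ctr b} \<union> A"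
      unfolding VH Rab using ab(4) by auto
    have imA: "\<phi> ` A \<subseteq> {(0, 0), (0, 2)}"
    proof (rule image_subsetI)
      fix l assume l: "l \<in> A"
      then show "\<phi> l \<in> {(0, 0), (0, 2)}"
        unfolding vals(2)[OF l] using g'[OF l] by (elim disjE) simp_all
    qed
    have im: "\<phi> ` {x, a, b, ctr b} = {(0, 1), (1, 0), (1, 2), (1, 1)}"
      by (simp add: vals)
    have inj\<phi>: "inj_on \<phi> (verts H)"
    proof -
      have "inj_on \<phi> A"
      proof (rule inj_onI)
        fix l l' assume l: "l \<in> A" "l' \<in> A" "\<phi> l = \<phi> l'"
        then have "g l = g l'" by (simp add: vals(2))
        then show "l = l'" using inj_onD[OF g(1)] l(1,2) by blast
      qed
      moreover have "inj_on \<phi> {x, a, b, ctr b}"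
        by (simp add: inj_on_def vals)
      moreover have "\<phi> ` {x, a, b, ctr b} \<inter> \<phi> ` A = {}"
        unfolding im using imA by auto
      ultimately have "inj_on \<phi> ({x, a, b, ctr b} \<union> A)"
        unfolding inj_on_Un by blast
      then show ?thesis
        unfolding VH' .
    qed
    have "{(0, 1), (1, 0), (1, 2), (1, 1)} \<subseteq> verts two_P3" "{(0, 0), (0, 2)} \<subseteq> verts two_P3"
      unfolding verts_two_P3 by simp_all
    then have img\<phi>: "\<phi> ` verts H \<subseteq> verts two_P3"
      unfolding VH' image_Un im using subset_trans[OF imA] by (intro Un_least) simp_all
    have edge\<phi>: "\<phi> ` e \<in> edges two_P3" if e: "e \<in> edges H" for e
    proof -
      obtain l where l: "l \<in> A \<or> l = a \<or> l = b" "e = {l, ctr l}"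
        using e LAR Rab by (auto simp: H(1))
      from l(1) show ?thesis
      proof (elim disjE)
        assume lA: "l \<in> A"
        have "\<phi> ` e = {(0, 1), (0, 2 * g l)}"
          unfolding l(2) using A[OF lA] lA by (simp add: vals insert_commute)
        then show ?thesis
          unfolding edges_two_P3 using g'[OF lA] by (elim disjE) simp_all
      next
        assume "l = a"
        then have "\<phi> ` e = {(1, 1), (1, 0)}"
          unfolding l(2) using ab(4) by (simp add: vals insert_commute)
        then show ?thesis unfolding edges_two_P3 by simp
      next
        assume "l = b"
        then have "\<phi> ` e = {(1, 1), (1, 2)}"
          unfolding l(2) by (simp add: vals insert_commute)
        then show ?thesis unfolding edges_two_P3 by simp
      qed
    qed
    show ?thesis
      by (rule disjI1) (rule exI, rule embeddingI[OF inj\<phi> img\<phi> edge\<phi>])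
  qed
qed

section \<open>The characterization\<close>

text \<open>The three colourings are the stripes, a rainbow star in row \<open>0\<close>, and a rainbow matching on the diagonal. The
  last two use the colours \<open>3, \<dots>, m\<close> for the star and the matching, and two alternating colours elsewhere.\<close>

lemma class_B_embeds:
  assumes "H \<in> class_B"
  shows "(\<exists>\<phi>. embedding \<phi> H two_P3) \<or> (\<exists>\<phi>. embedding \<phi> H claw_2K2)"
proof (rule class_B_rainbow_copy[OF assms])
  have H: "simple_graph H" "order H \<ge> 3" "no_isolated_vertices H"
    using assms by (simp_all add: class_B_def)
  fix m\<^sub>0
  assume m\<^sub>0: "\<And>m p g. m\<^sub>0 \<le> m \<Longrightarrow> 2 \<le> p \<Longrightarrow> (\<And>i j. m \<le> i \<Longrightarrow> g i j = Suc (i mod p)) \<Longrightarrow>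
      (\<And>i j. g i j \<in> {1..m}) \<Longrightarrow> (\<And>a. a \<in> {1..m} \<Longrightarrow> \<exists>i<m. \<exists>j<m. g i j = a) \<Longrightarrow>
      \<exists>s t. rainbow_copy (matrix_colouring g) H (K s t)"
  define m where "m = m\<^sub>0 + 3"
  have m: "m\<^sub>0 \<le> m" "3 \<le> m" by (simp_all add: m_def)
  have two: "Suc (i mod 2) \<in> {1, 2}" for i :: nat by auto
  have "\<exists>s t. rainbow_copy (matrix_colouring (\<lambda>i j. Suc (i mod m))) H (K s t)"
  proof (rule m\<^sub>0[OF m(1), of m])
    show "\<exists>i<m. \<exists>j<m. Suc (i mod m) = a" if "a \<in> {1..m}" for a
      using that by (intro exI[of _ "a - 1"] conjI exI[of _ 0]) auto
  qed (use m in \<open>auto simp: Suc_le_eq\<close>)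
  then obtain s t where "rainbow_copy (matrix_colouring (\<lambda>i j. Suc (i mod m))) H (K s t)"
    by (elim exE)
  from star_forest_of_stripes[OF H(1,3) this]
  obtain L ctr where L: "ctr ` L \<inter> L = {}" "edges H = (\<lambda>l. {l, ctr l}) ` L"
      "verts H = L \<union> ctr ` L"
    by (elim exE conjE)
  let ?star = "\<lambda>i j. if i = 0 \<and> j + 2 < m then j + 3 else Suc (i mod 2)"
  have "\<exists>s t. rainbow_copy (matrix_colouring ?star) H (K s t)"
  proof (rule m\<^sub>0[OF m(1), of 2])
    show "?star i j \<in> {1..m}" for i j
      using two[of i] m by auto
    show "\<exists>i<m. \<exists>j<m. ?star i j = a" if a: "a \<in> {1..m}" for a
    proof -
      consider "a = 1" | "a = 2" | "3 \<le> a" using a by fastforce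
      then show ?thesis
      proof cases
        case 1 then show ?thesis using m by (intro exI[of _ 2] conjI exI[of _ 0]) auto
      next
        case 2 then show ?thesis using m by (intro exI[of _ 1] conjI exI[of _ 0]) auto
      next
        case 3 then show ?thesis using m a by (intro exI[of _ 0] conjI exI[of _ "a - 3"]) auto
      qed
    qed
  qed (use m in auto)
  then obtain s t where "rainbow_copy (matrix_colouring ?star) H (K s t)"
    by (elim exE)
  from star_and_two_edges[OF H(1) _ this] two
  obtain v where v: "card {e \<in> edges H. v \<notin> e} \<le> 2"
    by auto
  let ?match = "\<lambda>i j. if i = j \<and> i + 2 < m then i + 3 else Suc (i mod 2)"
  have "\<exists>s t. rainbow_copy (matrix_colouring ?match) H (K s t)"
  proof (rule m\<^sub>0[OF m(1), of 2])
    show "?match i j \<in> {1..m}" for i j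
      using two[of i] m by auto
    show "\<exists>i<m. \<exists>j<m. ?match i j = a" if a: "a \<in> {1..m}" for a
    proof -
      consider "a = 1" | "a = 2" | "3 \<le> a" using a by fastforce
      then show ?thesis
      proof cases
        case 1 then show ?thesis using m by (intro exI[of _ 0] conjI exI[of _ 1]) auto
      next
        case 2 then show ?thesis using m by (intro exI[of _ 1] conjI exI[of _ 0]) auto
      next
        case 3 then show ?thesis using m a by (intro exI[of _ "a - 3"] conjI) auto
      qed
    qed
  qed (use m in auto)
  then obtain s t where "rainbow_copy (matrix_colouring ?match) H (K s t)"
    by (elim exE)
  from matching_and_two_edges[OF H(1) _ this] two
  obtain D where D: "finite D" "card D \<le> 2" "pairwise disjnt (edges H - D)"
    by auto
  have "finite L" "L \<noteq> {}"
    using H(1,2) L(3) by (auto simp: simple_graph_def order_def)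
  then show ?thesis
    using star_forest_embeds[OF _ _ L v D] by blast
qed

text \<open>The thresholds are \<open>m\<^sub>0 = k + 41\<close> and \<open>N\<^sub>0 = 2m + k + 3\<close>, with \<open>f = 2m\<close>.\<close>

lemma embeds_class_B:
  assumes H: "simple_graph H" "bipartite H" "order H \<ge> 3" "no_isolated_vertices H"
    and emb: "(\<exists>\<phi>. embedding \<phi> H two_P3) \<or> (\<exists>\<phi>. embedding \<phi> H claw_2K2)"
  shows "H \<in> class_B"
proof -
  have "\<exists>F. subgraph F (K s t) \<and> monochromatic c F \<and> k_connected k F \<and> s + t \<le> order F + 2 * m"
    if "max (38 + (k + 3)) (card (edges H)) \<le> m" "2 * m + k + 3 \<le> min s t"
      "coloring_using (K s t) m c" "rainbow_free H (K s t) c" for k m s t c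
  proof -
    have "\<not> rainbow_copy c H (K s t)"
      using that(4) rainbow_free_iff[OF H(1)] by blast
    then have "\<not> rainbow_copy c two_P3 (K s t) \<or> \<not> rainbow_copy c claw_2K2 (K s t)"
      using emb rainbow_copy_of_subgraph[OF H(1), of _ two_P3 c "K s t"]
        rainbow_copy_of_subgraph[OF H(1), of _ claw_2K2 c "K s t"] by blast
    then show ?thesis
      using that by (intro large_k_connected_monochromatic_subgraph) auto
  qed
  then show ?thesis
    using H unfolding class_B_def by blast
qed

theorem theorem1p9:
  fixes H :: "'a ugraph"
  assumes "simple_graph H" and "bipartite H" and "order H \<ge> 3" and "no_isolated_vertices H"
  shows "H \<in> class_B \<longleftrightarrow>
    (\<exists>F. subgraph F (copies 2 (path_graph 3)) \<and> graph_iso H F) \<or>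
    (\<exists>F. subgraph F (disjoint_union (copies 2 (complete_graph 2)) (complete_bipartite 1 3)) \<and>
         graph_iso H F)"
  unfolding copy_iff_embedding[OF assms(1)]
  using class_B_embeds embeds_class_B[OF assms] by blast

end
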